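(* Let $n\ge 1$, $t>0$, and let $f:\mathbb{C}^n\to\mathbb{C}$ be a measurable function such that $fK_z^t\in L^2(\mathbb{C}^n,\mu_t)$ for all $z\in\mathbb{C}^n$. Assume that $\widetilde{f}^{(s)}$ is bounded for some $s\in(0,t/2)$. Then there is a constant $C>0$ depending only on $t$, $s$ and $n$ such that the following hold. (i) For every $1\le p\le\infty$, the integral operator $I_f^t:L_t^p\to F_t^p$ defined by $$I_f^t g(z):=\int_{\mathbb{C}^n} e^{\frac{1}{2t}|z-w|^2+\frac1t\operatorname{Re}(z\cdot\overline w)}\,\widetilde f^{(t)}(w,z)\,g(w)\,d\mu_t(w)$$ is bounded, and $$\|I_f^t\|_{L_t^p\to F_t^p}\le C\,\|\widetilde f^{(s)}\|_\infty .$$ (ii) In particular, for every $1\le p<\infty$ the Toeplitz operator $T_f^t:F_t^p\to F_t^p$ is bounded with the same norm bound $$\|T_f^t\|_{F_t^p\to F_t^p}\le C\,\|\widetilde f^{(s)}\|_\infty .$$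
   Context: Let $V$ be Lebesgue measure on $\mathbb{C}^n\cong\mathbb{R}^{2n}$, $z\cdot\overline w=\sum_j z_j\overline{w_j}$, $|z|^2=z\cdot\overline z$. For $t>0$ let $d\mu_t(z)=\frac{1}{(\pi t)^n}e^{-|z|^2/t}\,dV(z)$. For $1\le p<\infty$: $L_t^p:=L^p(\mathbb{C}^n,\mu_{2t/p})$ and $F_t^p:=L_t^p\cap\mathrm{Hol}(\mathbb{C}^n)$, with the $L^p(\mu_{2t/p})$-norm. For $p=\infty$: $\|g\|_{L_t^\infty}=\operatorname{ess\,sup}_{z}|g(z)e^{-\frac{1}{2t}|z|^2}|$, $L_t^\infty$ is the space of measurable $g$ with $\|g\|_{L_t^\infty}<\infty$, and $F_t^\infty:=L_t^\infty\cap\mathrm{Hol}(\mathbb{C}^n)$ with the same norm. $F_t^2$ is a reproducing kernel Hilbert space with inner product $\langle g,h\rangle_t=\int g\overline h\,d\mu_t$ and kernel $K_z^t(w)=K^t(w,z)=e^{w\cdot\overline z/t}$; the normalized kernel is $k_z^t=K_z^t/\sqrt{K^t(z,z)}$. We write $\langle g,h\rangle_t=\int g\overline h\,d\mu_t$ whenever the integral converges. The (off-diagonal) Berezin transform is $\widetilde f^{(t)}(z,w):=\langle fk_z^t,k_w^t\rangle_t$, and $\widetilde f^{(t)}(z):=\widetilde f^{(t)}(z,z)$. If $fK_z^t\in L^2(\mu_t)$ for all $z$, then $fK_z^s\in L^2(\mu_s)$ for all $z$ and all $0<s\le t$, so $\widetilde f^{(s)}(z)=\langle fk_z^s,k_z^s\rangle_s$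 is defined for these $s$. The projection $P^t:L_t^p\to F_t^p$ is the bounded integral operator $P^tg(z)=\int_{\mathbb{C}^n}g(w)e^{z\cdot\overline w/t}\,d\mu_t(w)$. The Toeplitz operator is $T_f^th=P^t(fh)$, on the domain $D(T_f^t)=\{h\in F_t^p: fh\in L_t^p\}$; a norm bound $\|T_f^t\|_{F_t^p\to F_t^p}\le M$ means $\|T_f^th\|\le M\|h\|$ for all $h$ in this domain. *)

theory Defs
  imports "HOL-Probability.Probability"
begin

text \<open>
  Points of complex n-space are vectors of type \<^typ>\<open>complex ^ 'n\<close>, with n = \<open>CARD('n)\<close>.
  Its \<^const>\<open>norm\<close> is the Euclidean norm, and \<^const>\<open>lebesgue\<close> on this type is Lebesgue
  measure on real 2n-space.
\<close>

definition hdot :: "complex ^ 'n::finite \<Rightarrow> complex ^ 'n \<Rightarrow> complex" where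
  "hdot z w = (\<Sum>j\<in>UNIV. z $ j * cnj (w $ j))"

definition gauss :: "real \<Rightarrow> (complex ^ 'n::finite) measure" where
  "gauss t = density lebesgue
     (\<lambda>z. ennreal (1 / (pi * t) ^ CARD('n) * exp (- (norm z)\<^sup>2 / t)))"

text \<open>Holomorphic: complex Frechet differentiable at every point (joint differentiability, with
  complex-linear derivative).\<close>

definition entire :: "(complex ^ 'n::finite \<Rightarrow> complex) \<Rightarrow> bool" where
  "entire g \<longleftrightarrow>
     (\<forall>z. \<exists>D. (g has_derivative D) (at z) \<and> (\<forall>c v. D (c *s v) = c * D v))"

text \<open>Elements of the Lebesgue spaces are functions, not classes modulo null sets.\<close>

definition Lp_space :: "'a measure \<Rightarrow> real \<Rightarrow> ('a \<Rightarrow> complex) set" where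
  "Lp_space M p = {g \<in> borel_measurable M. integrable M (\<lambda>x. cmod (g x) powr p)}"

definition Lp_norm :: "'a measure \<Rightarrow> real \<Rightarrow> ('a \<Rightarrow> complex) \<Rightarrow> real" where
  "Lp_norm M p g = (LINT x|M. cmod (g x) powr p) powr (1 / p)"

text \<open>The exponent ranges over \<^typ>\<open>ennreal\<close> so as to include infinity. For finite exponents
  the Gaussian measure depends on the exponent; for the infinite one the weight is part of the
  essential supremum, taken with respect to Lebesgue measure.\<close>

definition Linf_t_norm :: "real \<Rightarrow> (complex ^ 'n::finite \<Rightarrow> complex) \<Rightarrow> ennreal" where
  "Linf_t_norm t g =
     esssup lebesgue (\<lambda>z. ennreal (cmod (g z * of_real (exp (- (norm z)\<^sup>2 / (2 * t))))))"

definition Lt_space :: "real \<Rightarrow> ennreal \<Rightarrow> (complex ^ 'n::finite \<Rightarrow> complex) set" where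
  "Lt_space t p =
     (if p = \<infinity> then {g \<in> borel_measurable lebesgue. Linf_t_norm t g < \<infinity>}
      else Lp_space (gauss (2 * t / enn2real p)) (enn2real p))"

definition Lt_norm :: "real \<Rightarrow> ennreal \<Rightarrow> (complex ^ 'n::finite \<Rightarrow> complex) \<Rightarrow> real" where
  "Lt_norm t p g =
     (if p = \<infinity> then enn2real (Linf_t_norm t g)
      else Lp_norm (gauss (2 * t / enn2real p)) (enn2real p) g)"

definition Ft_space :: "real \<Rightarrow> ennreal \<Rightarrow> (complex ^ 'n::finite \<Rightarrow> complex) set" where
  "Ft_space t p = {g \<in> Lt_space t p. entire g}"

definition inner_t ::
  "real \<Rightarrow> (complex ^ 'n::finite \<Rightarrow> complex) \<Rightarrow> (complex ^ 'n \<Rightarrow> complex) \<Rightarrow> complex" where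
  "inner_t t g h = (LINT u|gauss t. g u * cnj (h u))"

definition K :: "real \<Rightarrow> complex ^ 'n::finite \<Rightarrow> complex ^ 'n \<Rightarrow> complex" where
  "K t z = (\<lambda>w. exp (hdot w z / of_real t))"

text \<open>The value of \<^const>\<open>K\<close> on the diagonal is a positive real number, so the complex square
  root is the usual one.\<close>

definition nK :: "real \<Rightarrow> complex ^ 'n::finite \<Rightarrow> complex ^ 'n \<Rightarrow> complex" where
  "nK t z = (\<lambda>w. K t z w / csqrt (K t z z))"

definition berezin ::
  "real \<Rightarrow> (complex ^ 'n::finite \<Rightarrow> complex) \<Rightarrow> complex ^ 'n \<Rightarrow> complex ^ 'n \<Rightarrow> complex" where
  "berezin t f z w = inner_t t (\<lambda>u. f u * nK t z u) (nK t w)"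

definition berezin_diag ::
  "real \<Rightarrow> (complex ^ 'n::finite \<Rightarrow> complex) \<Rightarrow> complex ^ 'n \<Rightarrow> complex" where
  "berezin_diag t f z = berezin t f z z"

text \<open>Supremum norm; meaningful for bounded functions only.\<close>

definition sup_norm :: "('a \<Rightarrow> complex) \<Rightarrow> real" where
  "sup_norm g = (SUP z. cmod (g z))"

definition I_integrand ::
  "real \<Rightarrow> (complex ^ 'n::finite \<Rightarrow> complex) \<Rightarrow> (complex ^ 'n \<Rightarrow> complex) \<Rightarrow>
     complex ^ 'n \<Rightarrow> complex ^ 'n \<Rightarrow> complex" where
  "I_integrand t f g z w =
     of_real (exp (1 / (2 * t) * (norm (z - w))\<^sup>2 + 1 / t * Re (hdot z w)))
       * berezin t f w z * g w"

definition I_op ::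
  "real \<Rightarrow> (complex ^ 'n::finite \<Rightarrow> complex) \<Rightarrow> (complex ^ 'n \<Rightarrow> complex) \<Rightarrow>
     complex ^ 'n \<Rightarrow> complex" where
  "I_op t f g z = (LINT w|gauss t. I_integrand t f g z w)"

definition P_integrand ::
  "real \<Rightarrow> (complex ^ 'n::finite \<Rightarrow> complex) \<Rightarrow> complex ^ 'n \<Rightarrow> complex ^ 'n \<Rightarrow> complex" where
  "P_integrand t g z w = g w * exp (hdot z w / of_real t)"

definition P_op ::
  "real \<Rightarrow> (complex ^ 'n::finite \<Rightarrow> complex) \<Rightarrow> complex ^ 'n \<Rightarrow> complex" where
  "P_op t g z = (LINT w|gauss t. P_integrand t g z w)"

definition toeplitz ::
  "real \<Rightarrow> (complex ^ 'n::finite \<Rightarrow> complex) \<Rightarrow> (complex ^ 'n \<Rightarrow> complex) \<Rightarrow>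
     complex ^ 'n \<Rightarrow> complex" where
  "toeplitz t f h = P_op t (\<lambda>w. f w * h w)"

definition toeplitz_dom ::
  "real \<Rightarrow> ennreal \<Rightarrow> (complex ^ 'n::finite \<Rightarrow> complex) \<Rightarrow> (complex ^ 'n \<Rightarrow> complex) set" where
  "toeplitz_dom t p f = {h \<in> Ft_space t p. (\<lambda>w. f w * h w) \<in> Lt_space t p}"

end

theory Submission
  imports Defs "HOL-Complex_Analysis.Cauchy_Integral_Formula"
begin

text \<open>
  Convolving \<open>berezin_diag s f\<close> with the Gaussian of variance parameter \<open>r = t - s\<close> gives the
  Berezin transform at time \<open>t\<close>. Replacing \<open>|v - z|^2\<close> in that Gaussian by \<open>hdot (v - a) (v - b)\<close>
  continues this identity off the diagonal, at the price of a factor \<open>exp (|a - b|^2 / (4 r))\<close>, while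
  the normalisation contributes \<open>exp (- |a - b|^2 / (2 t))\<close>. As \<open>s < t / 2\<close>, the off-diagonal Berezin
  transform has Gaussian decay in \<open>|a - b|\<close>, so that after absorbing the weights the operator
  \<open>I_op t f\<close> is dominated by convolution with an integrable Gaussian, and part (i) follows from
  Young's inequality. Fubini gives \<open>I_op t f = P_op t \<circ> f \<circ> P_op t\<close>; since \<open>P_op t\<close> reproduces entire
  functions, Toeplitz operators are restrictions of \<open>I_op t f\<close>, which is part (ii).
\<close>

section \<open>Isometry invariance of Lebesgue measure\<close>

text \<open>The continuation off the diagonal is never carried out as such: completing a square in a
  complex exponent would mean shifting contours in n complex variables. Instead the antiholomorphic
  half of the exponential is recognised as a reproducing kernel, so that the complex Gaussian
  integral becomes a value of \<open>P_op\<close> on an entire exponential. The reproducing formula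
  thus serves twice, here and in the passage from (i) to (ii). It rests on averaging over the
  rotations of all coordinates by a common phase, hence the interest in isometries of Lebesgue
  measure, and it uses Cauchy's formula in one variable only.

  The value \<open>r = t - s\<close> is forced, since the parameters of Gaussians add under
  convolution. Growth at rate \<open>1 / (4 * r)\<close> loses against decay at rate
  \<open>1 / (2 * t)\<close> exactly when \<open>2 * r > t\<close>, that is, when
  \<open>s < t / 2\<close>.

  As f itself may be unbounded, a bounded transform controls sizes but not convergence. Every
  exchange of integrals is paid for by the square integrability of f times the kernels, and the
  constants of those estimates never enter the norm bound.\<close>

lemma nn_integral_gaussian_real:
  assumes "a > 0"
  shows "(\<integral>\<^sup>+x. ennreal (exp (- a * x\<^sup>2)) \<partial>(lborel :: real measure)) = ennreal (sqrt (pi / a))"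
proof -
  define \<sigma> where "\<sigma> = sqrt (1 / (2 * a))"
  have s: "\<sigma> > 0" "\<sigma>\<^sup>2 = 1 / (2 * a)" using assms by (auto simp: \<sigma>_def)
  have "(\<lambda>x. sqrt (pi / a) * normal_density 0 \<sigma> x) = (\<lambda>x. exp (- a * x\<^sup>2))"
    using assms by (auto simp: normal_density_def s fun_eq_iff field_simps real_sqrt_divide)
  moreover have "has_bochner_integral lborel (\<lambda>x. sqrt (pi / a) * normal_density 0 \<sigma> x) (sqrt (pi / a) * 1)"
    using s(1) by (intro has_bochner_integral_mult_right) (simp_all add: has_bochner_integral_iff integral_normal_density)
  ultimately have "has_bochner_integral lborel (\<lambda>x. exp (- a * x\<^sup>2)) (sqrt (pi / a))"
    by simp
  then show ?thesis
    by (subst nn_integral_eq_integral) (auto simp: has_bochner_integral_iff)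
qed

lemma norm_sq_sum_Basis: "(norm x)\<^sup>2 = (\<Sum>b\<in>Basis. (x \<bullet> b)\<^sup>2)"
  for x :: "'a::euclidean_space"
  unfolding power2_norm_eq_inner by (subst euclidean_inner) (simp add: power2_eq_square)

lemma nn_integral_gaussian_0:
  assumes "a > 0"
  shows "(\<integral>\<^sup>+x. ennreal (exp (- a * (norm x)\<^sup>2)) \<partial>(lborel :: 'a::euclidean_space measure)) =
    ennreal (sqrt (pi / a) ^ DIM('a))"
proof -
  have "(\<integral>\<^sup>+x. ennreal (exp (- a * (norm x)\<^sup>2)) \<partial>(lborel :: 'a::euclidean_space measure))
     = (\<integral>\<^sup>+x. (\<Prod>b\<in>Basis. ennreal (exp (- a * (x \<bullet> b)\<^sup>2))) \<partial>(lborel :: 'a measure))"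
    by (simp add: norm_sq_sum_Basis exp_sum[symmetric] prod_ennreal sum_distrib_left sum_negf[symmetric])
  also have "\<dots> = (\<Prod>b\<in>(Basis::'a set). ennreal (sqrt (pi / a)))"
    using assms by (subst nn_integral_lborel_prod) (auto simp: nn_integral_gaussian_real[simplified])
  finally show ?thesis using assms by (simp add: ennreal_power)
qed

lemma nn_integral_lborel_translate:
  fixes f :: "'a::euclidean_space \<Rightarrow> ennreal"
  assumes [measurable]: "f \<in> borel_measurable borel"
  shows "(\<integral>\<^sup>+x. f (x + c) \<partial>lborel) = (\<integral>\<^sup>+x. f x \<partial>lborel)"
  by (subst (2) lborel_distr_plus[symmetric, of c]) (simp add: nn_integral_distr add.commute)

lemma nn_integral_gaussian:
  assumes "a > 0"
  shows "(\<integral>\<^sup>+x. ennreal (exp (- a * (norm (x - m))\<^sup>2)) \<partial>(lborel :: 'a::euclidean_space measure)) =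
    ennreal (sqrt (pi / a) ^ DIM('a))"
  using nn_integral_lborel_translate[of "\<lambda>x. ennreal (exp (- a * (norm x)\<^sup>2))" "-m"] nn_integral_gaussian_0[OF assms]
  by simp

text \<open>Convolving with a Gaussian, which is invariant under isometries, turns translation invariance
  into invariance under linear isometries.\<close>

lemma nn_integral_lborel_isometry:
  fixes f :: "'a::euclidean_space \<Rightarrow> ennreal" and T :: "'a \<Rightarrow> 'a"
  assumes T: "orthogonal_transformation T" and [measurable]: "f \<in> borel_measurable borel"
  shows "(\<integral>\<^sup>+x. f (T x) \<partial>lborel) = (\<integral>\<^sup>+x. f x \<partial>lborel)"
proof -
  define S where "S = inv T"
  have TS: "T (S y) = y" for y
    unfolding S_def using orthogonal_transformation_surj[OF T] by (simp add: surj_f_inv_f)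
  have linT: "linear T" using T by (rule orthogonal_transformation_linear)
  have nT: "norm (T x) = norm x" for x using T by (simp add: orthogonal_transformation_norm)
  have [measurable]: "T \<in> borel_measurable borel"
    using linT by (simp add: linear_continuous_on linear_conv_bounded_linear borel_measurable_continuous_onI)
  define \<gamma> where "\<gamma> = (\<lambda>x::'a. ennreal (exp (- 1 * (norm x)\<^sup>2)))"
  define c where "c = ennreal (sqrt (pi / 1) ^ DIM('a))"
  have [measurable]: "\<gamma> \<in> borel_measurable borel" by (simp add: \<gamma>_def)
  have c: "(\<integral>\<^sup>+x. \<gamma> (x - m) \<partial>lborel) = c" for m
    unfolding \<gamma>_def c_def by (rule nn_integral_gaussian) simp
  have c0: "c \<noteq> 0" "c \<noteq> top" by (auto simp: c_def)
  \<comment> \<open>The mass \<open>c\<close> enters as an outer integral in y. Because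
    \<open>T (x + S y) = T x + y\<close>, shifting x by \<open>S y\<close> and then y by
    \<open>- T x\<close> moves the whole dependence on T into \<open>\<gamma>\<close>. There
    \<open>norm (y - T x) = norm (x - S y)\<close>, so the Gaussian can be integrated out in x.
    Cancelling \<open>c\<close> is sound even for an infinite integral, as \<open>c\<close> is
    neither 0 nor \<open>top\<close>.\<close>
  have "c * (\<integral>\<^sup>+x. f (T x) \<partial>lborel) = (\<integral>\<^sup>+y. \<gamma> y * (\<integral>\<^sup>+x. f (T x) \<partial>lborel) \<partial>lborel)"
    using c[of 0] by (simp add: nn_integral_multc)
  also have "\<dots> = (\<integral>\<^sup>+y. \<gamma> y * (\<integral>\<^sup>+x. f (T x + y) \<partial>lborel) \<partial>lborel)"
  proof -
    have "(\<integral>\<^sup>+x. f (T x + y) \<partial>lborel) = (\<integral>\<^sup>+x. f (T x) \<partial>lborel)" for y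
      using nn_integral_lborel_translate[of "\<lambda>x. f (T x)" "S y"]
      by (simp add: linear_add[OF linT] TS)
    then show ?thesis by simp
  qed
  also have "\<dots> = (\<integral>\<^sup>+y. (\<integral>\<^sup>+x. \<gamma> y * f (T x + y) \<partial>lborel) \<partial>lborel)"
    by (simp add: nn_integral_cmult)
  also have "\<dots> = (\<integral>\<^sup>+x. (\<integral>\<^sup>+y. \<gamma> y * f (T x + y) \<partial>lborel) \<partial>lborel)"
    by (rule lborel_pair.Fubini') measurable
  also have "\<dots> = (\<integral>\<^sup>+x. (\<integral>\<^sup>+y. \<gamma> (y - T x) * f y \<partial>lborel) \<partial>lborel)"
  proof -
    have "(\<integral>\<^sup>+y. \<gamma> y * f (T x + y) \<partial>lborel) = (\<integral>\<^sup>+y. \<gamma> (y - T x) * f y \<partial>lborel)" for x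
      using nn_integral_lborel_translate[of "\<lambda>y. \<gamma> (y - T x) * f y" "T x"]
      by (simp add: add.commute)
    then show ?thesis by simp
  qed
  also have "\<dots> = (\<integral>\<^sup>+y. (\<integral>\<^sup>+x. \<gamma> (y - T x) * f y \<partial>lborel) \<partial>lborel)"
    by (rule lborel_pair.Fubini') measurable
  also have "\<dots> = (\<integral>\<^sup>+y. c * f y \<partial>lborel)"
  proof -
    have "\<gamma> (y - T x) = \<gamma> (x - S y)" for x y
    proof -
      have "norm (y - T x) = norm (T (S y - x))" by (simp add: linear_diff[OF linT] TS)
      then show ?thesis by (simp add: \<gamma>_def nT norm_minus_commute)
    qed
    then show ?thesis by (simp add: nn_integral_multc c)
  qed
  also have "\<dots> = c * (\<integral>\<^sup>+y. f y \<partial>lborel)" by (simp add: nn_integral_cmult)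
  finally show ?thesis using c0 by (simp add: ennreal_mult_cancel_left)
qed

lemma lborel_distr_isometry:
  fixes T :: "'a::euclidean_space \<Rightarrow> 'a"
  assumes T: "orthogonal_transformation T"
  shows "distr lborel borel T = lborel"
proof (rule measure_eqI)
  have [measurable]: "T \<in> borel_measurable borel"
    using orthogonal_transformation_linear[OF T]
    by (simp add: linear_continuous_on linear_conv_bounded_linear borel_measurable_continuous_onI)
  fix A assume "A \<in> sets (distr lborel borel T)"
  then have [measurable]: "A \<in> sets borel" by simp
  have "emeasure (distr lborel borel T) A = (\<integral>\<^sup>+x. indicator A x \<partial>distr lborel borel T)" by simp
  also have "\<dots> = (\<integral>\<^sup>+x. indicator A (T x) \<partial>lborel)" by (rule nn_integral_distr) auto
  also have "\<dots> = (\<integral>\<^sup>+x. indicator A x \<partial>lborel)"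
    by (rule nn_integral_lborel_isometry[OF T]) simp
  finally show "emeasure (distr lborel borel T) A = emeasure lborel A" by simp
qed simp

section \<open>Gaussian integrals over complex n-space\<close>

lemma has_bochner_integral_gaussian:
  fixes m :: "complex ^ 'n::finite"
  assumes "a > 0"
  shows "has_bochner_integral lborel (\<lambda>z. exp (- a * (norm (z - m))\<^sup>2)) ((pi / a) ^ CARD('n))"
proof -
  have "sqrt (pi / a) ^ DIM(complex ^ 'n) = (pi / a) ^ CARD('n)"
    using assms by (simp add: power_mult mult.commute[of "CARD('n)"])
  then show ?thesis
    using nn_integral_gaussian[OF assms, of m] assms
    by (intro has_bochner_integral_nn_integral) auto
qed

text \<open>Half of the Gaussian pays for the linear term: completing the square bounds
  \<open>b * r\<close> by \<open>(a / 2) * r\<^sup>2 + b\<^sup>2 / (2 * a)\<close>.\<close>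

lemma integrable_gaussian_dominated:
  fixes q :: "complex ^ 'n::finite \<Rightarrow> 'b::{banach, second_countable_topology}"
  assumes [measurable]: "q \<in> borel_measurable borel" and a: "a > 0"
    and q: "\<And>y. norm (q y) \<le> exp (- a * (norm y)\<^sup>2 + b * norm y + c)"
  shows "integrable lborel q"
proof (rule Bochner_Integration.integrable_bound)
  show "integrable lborel (\<lambda>y::complex^'n. exp (b\<^sup>2 / (2 * a) + c) * exp (- (a / 2) * (norm (y - 0))\<^sup>2))"
    using has_bochner_integral_gaussian[of "a / 2" "0 :: complex ^ 'n"] a
    by (intro integrable_mult_right) (auto simp: has_bochner_integral_iff)
  have "- a * r\<^sup>2 + b * r + c \<le> b\<^sup>2 / (2 * a) + c - (a / 2) * r\<^sup>2" for r
  proof -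
    have "0 \<le> (a / 2) * (r - b / a)\<^sup>2" using a by simp
    also have "\<dots> = (a / 2) * r\<^sup>2 - b * r + b\<^sup>2 / (2 * a)"
      using a by (simp add: power2_eq_square field_simps)
    finally show ?thesis by simp
  qed
  then show "AE y in lborel. norm (q y) \<le> norm (exp (b\<^sup>2 / (2 * a) + c) * exp (- (a / 2) * (norm (y - 0))\<^sup>2))"
    by (intro always_eventually allI order_trans[OF q]) (simp add: exp_add[symmetric])
qed simp

section \<open>The Hermitian form\<close>

lemma hdot_add_left: "hdot (x + y) z = hdot x z + hdot y z"
  and hdot_add_right: "hdot z (x + y) = hdot z x + hdot z y"
  and hdot_diff_left: "hdot (x - y) z = hdot x z - hdot y z"
  and hdot_diff_right: "hdot z (x - y) = hdot z x - hdot z y"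
  and hdot_scaleR_left: "hdot (r *\<^sub>R x) z = of_real r * hdot x z"
  and hdot_scaleR_right: "hdot z (r *\<^sub>R x) = of_real r * hdot z x"
  and hdot_smult_left: "hdot (c *s x) z = c * hdot x z"
  and hdot_0_left [simp]: "hdot 0 z = 0"
  by (simp_all add: hdot_def sum.distrib sum_subtractf ring_distribs sum_distrib_left)
     (simp_all add: scaleR_conv_of_real ac_simps)

lemma cnj_hdot: "cnj (hdot x y) = hdot y x"
  by (simp add: hdot_def mult.commute)

text \<open>The bridge to real 2n-space: moduli of exponentials are computed in the real inner
  product, while holomorphy is read off from \<open>hdot\<close>.\<close>

lemma Re_hdot: "Re (hdot x y) = x \<bullet> y"
  by (simp add: hdot_def inner_vec_def inner_complex_def)

lemma hdot_self: "hdot x x = of_real ((norm x)\<^sup>2)"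
  by (simp add: complex_eq_iff Re_hdot power2_norm_eq_inner)
     (simp add: hdot_def mult.commute)

lemma of_real_norm_sq: "(complex_of_real (norm x))\<^sup>2 = hdot x x"
  by (simp add: hdot_self)

lemma norm_hdot_le: "cmod (hdot x y) \<le> norm x * norm y"
proof -
  have "cmod (hdot x y) \<le> (\<Sum>j\<in>UNIV. norm (x $ j) * norm (y $ j))"
    unfolding hdot_def by (rule order_trans[OF norm_sum]) (simp add: norm_mult)
  also have "\<dots> \<le> L2_set (\<lambda>j. norm (x $ j)) UNIV * L2_set (\<lambda>j. norm (y $ j)) UNIV"
    using L2_set_mult_ineq[of "\<lambda>j. norm (x $ j)" "\<lambda>j. norm (y $ j)" UNIV] by simp
  finally show ?thesis by (simp add: norm_vec_def)
qed

text \<open>Bilinearity over the reals is all that a sesquilinear form offers; it yields continuity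
  and the derivative in the first argument.\<close>

lemma bounded_bilinear_hdot: "bounded_bilinear (hdot :: complex ^ 'n::finite \<Rightarrow> _)"
  by (rule bounded_bilinear.intro)
     (auto simp: hdot_add_left hdot_add_right hdot_scaleR_left hdot_scaleR_right scaleR_conv_of_real[where 'a=complex]
        intro!: exI[of _ 1] norm_hdot_le)

lemmas continuous_on_hdot [continuous_intros] = bounded_bilinear.continuous_on[OF bounded_bilinear_hdot]

lemma borel_measurable_hdot [measurable (raw)]:
  assumes "f \<in> borel_measurable M" "g \<in> borel_measurable M"
  shows "(\<lambda>x. hdot (f x) (g x)) \<in> borel_measurable M"
  by (rule borel_measurable_continuous_Pair[OF assms]) (intro continuous_intros)

section \<open>Entire functions of several variables\<close>

lemma entire_exp_hdot: "entire (\<lambda>v. exp (hdot v u / c))"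
  unfolding entire_def
proof (intro allI exI conjI)
  fix z
  have "((\<lambda>v. hdot v u / c) has_derivative (\<lambda>v. hdot v u / c)) (at z)"
    by (rule bounded_linear_imp_has_derivative)
       (intro bounded_linear_const_mult bounded_linear_divide bounded_bilinear.bounded_linear_left[OF bounded_bilinear_hdot]
         bounded_linear_compose[OF bounded_linear_divide])
  moreover have "(exp has_derivative (\<lambda>x. exp (hdot z u / c) * x)) (at (hdot z u / c))"
    using DERIV_exp unfolding has_field_derivative_def .
  ultimately show "((\<lambda>v. exp (hdot v u / c)) has_derivative (\<lambda>v. exp (hdot z u / c) * (hdot v u / c))) (at z)"
    by (rule has_derivative_compose)
qed (simp add: hdot_smult_left)

lemma entire_translate: "entire h \<Longrightarrow> entire (\<lambda>v. h (u + v))"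
  unfolding entire_def
proof (intro allI)
  fix z assume "\<forall>z. \<exists>D. (h has_derivative D) (at z) \<and> (\<forall>c v. D (c *s v) = c * D v)"
  then obtain D where D: "(h has_derivative D) (at (u + z))" "\<forall>c v. D (c *s v) = c * D v" by blast
  have "((\<lambda>v. h (u + v)) has_derivative (\<lambda>v. D v)) (at z)"
    using has_derivative_compose[of "\<lambda>v. u + v" "\<lambda>v. v" z UNIV h D] D(1)
      has_derivative_add[OF has_derivative_const[of u "at z"] has_derivative_ident[of "at z"]]
    by simp
  then show "\<exists>D. ((\<lambda>v. h (u + v)) has_derivative D) (at z) \<and> (\<forall>c v. D (c *s v) = c * D v)"
    using D(2) by blast
qed

lemma entire_mult: "entire f \<Longrightarrow> entire g \<Longrightarrow> entire (\<lambda>v. f v * g v)"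
  unfolding entire_def
proof (intro allI)
  fix z assume "\<forall>z. \<exists>D. (f has_derivative D) (at z) \<and> (\<forall>c v. D (c *s v) = c * D v)"
    and "\<forall>z. \<exists>D. (g has_derivative D) (at z) \<and> (\<forall>c v. D (c *s v) = c * D v)"
  then obtain D E where D: "(f has_derivative D) (at z)" "\<forall>c v. D (c *s v) = c * D v"
    and E: "(g has_derivative E) (at z)" "\<forall>c v. E (c *s v) = c * E v" by meson
  have "((\<lambda>v. f v * g v) has_derivative (\<lambda>v. f z * E v + D v * g z)) (at z)"
    by (rule has_derivative_mult[OF D(1) E(1)])
  then show "\<exists>D. ((\<lambda>v. f v * g v) has_derivative D) (at z) \<and> (\<forall>c v. D (c *s v) = c * D v)"
    using D(2) E(2) by (intro exI[of _ "\<lambda>v. f z * E v + D v * g z"]) (simp add: algebra_simps)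
qed

lemma entire_continuous: "entire g \<Longrightarrow> continuous_on UNIV g"
  by (meson continuous_at_imp_continuous_on entire_def has_derivative_continuous)

lemma entire_borel_measurable: "entire g \<Longrightarrow> g \<in> borel_measurable borel"
  by (intro borel_measurable_continuous_onI entire_continuous)

lemma norm_smult: "norm (c *s v) = cmod c * norm v"
  for v :: "complex ^ 'n::finite"
  by (simp add: norm_vec_def norm_mult L2_set_right_distrib)

lemma bounded_linear_smult: "bounded_linear (\<lambda>\<zeta>. \<zeta> *s v)"
  for v :: "complex ^ 'n::finite"
  by (rule bounded_linear_intro[where K = "norm v"])
     (auto simp: norm_smult vec_eq_iff algebra_simps scaleR_conv_of_real[where 'a=complex])

text \<open>Complex linearity of the derivative is what makes the chain rule along a complex line
  give multiplication by the number \<open>D v\<close>, that is, a complex derivative in one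
  variable.\<close>

lemma entire_slice_holomorphic:
  assumes "entire g"
  shows "(\<lambda>\<zeta>. g (\<zeta> *s v)) holomorphic_on UNIV"
proof (rule holomorphic_onI)
  fix \<zeta> :: complex
  obtain D where D: "(g has_derivative D) (at (\<zeta> *s v))" "\<And>c v. D (c *s v) = c * D v"
    using assms unfolding entire_def by blast
  have "((\<lambda>\<zeta>. \<zeta> *s v) has_derivative (\<lambda>\<zeta>. \<zeta> *s v)) (at \<zeta>)"
    by (rule bounded_linear_imp_has_derivative[OF bounded_linear_smult])
  then have "((\<lambda>\<zeta>. g (\<zeta> *s v)) has_derivative (\<lambda>x. D (x *s v))) (at \<zeta>)"
    by (rule has_derivative_compose) (rule D)
  then have "((\<lambda>\<zeta>. g (\<zeta> *s v)) has_field_derivative D v) (at \<zeta>)"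
    by (simp add: D has_field_derivative_def mult.commute[of _ "D v"] mult_commute_abs)
  then show "(\<lambda>\<zeta>. g (\<zeta> *s v)) field_differentiable at \<zeta> within UNIV"
    by (auto simp: field_differentiable_def)
qed

section \<open>Mean value property and reproducing formula\<close>

text \<open>Cauchy's formula at the centre of the unit circle. In this parametrisation the velocity
  is \<open>2 * pi * \<i>\<close> times the point itself, which cancels the Cauchy kernel and leaves
  a plain average. The Lebesgue form of the integral prepares it for Fubini.\<close>

lemma holomorphic_circle_mean:
  assumes "\<phi> holomorphic_on UNIV"
  shows "(LBINT x:{0..1}. \<phi> (cis (2 * pi * x))) = \<phi> 0"
proof -
  have con: "continuous_on A \<phi>" for A
    using assms holomorphic_on_imp_continuous_on continuous_on_subset by blast
  have "((\<lambda>u. \<phi> u / (u - 0)) has_contour_integral 2 * complex_of_real pi * \<i> * \<phi> 0) (circlepath 0 1)"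
    using assms con by (intro Cauchy_integral_circlepath) (auto intro: holomorphic_on_subset)
  then have "((\<lambda>x. \<phi> (circlepath 0 1 x) / circlepath 0 1 x * vector_derivative (circlepath 0 1) (at x within {0..1}))
      has_integral 2 * complex_of_real pi * \<i> * \<phi> 0) {0..1}"
    by (simp add: has_contour_integral_def)
  then have "((\<lambda>x. 2 * complex_of_real pi * \<i> * \<phi> (cis (2 * pi * x))) has_integral 2 * complex_of_real pi * \<i> * \<phi> 0) {0..1}"
  proof (rule has_integral_eq[rotated])
    fix x :: real assume x: "x \<in> {0..1}"
    have "circlepath 0 1 x = cis (2 * pi * x)"
      by (simp add: circlepath cis_conv_exp mult_ac)
    moreover have "vector_derivative (circlepath 0 1) (at x within {0..1}) = 2 * complex_of_real pi * \<i> * cis (2 * pi * x)"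
      using x by (simp add: vector_derivative_circlepath01 cis_conv_exp mult_ac)
    ultimately show "\<phi> (circlepath 0 1 x) / circlepath 0 1 x * vector_derivative (circlepath 0 1) (at x within {0..1}) =
        2 * complex_of_real pi * \<i> * \<phi> (cis (2 * pi * x))"
      by simp
  qed
  from has_integral_mult_right[OF this, of "inverse (2 * complex_of_real pi * \<i>)"]
  have "((\<lambda>x. \<phi> (cis (2 * pi * x))) has_integral \<phi> 0) {0..1}"
    by (simp add: field_simps)
  moreover have "set_integrable lborel {0..1} (\<lambda>x. \<phi> (cis (2 * pi * x)))"
    by (intro borel_integrable_atLeastAtMost' continuous_on_compose2[OF con] continuous_intros) auto
  ultimately show ?thesis
    by (metis has_integral_unique has_integral_set_lebesgue integrable_integral set_borel_integral_eq_integral)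
qed

lemma orthogonal_transformation_smult:
  assumes "cmod c = 1"
  shows "orthogonal_transformation (\<lambda>v::complex ^ 'n::finite. c *s v)"
  unfolding orthogonal_transformation
proof
  show "linear (\<lambda>v::complex ^ 'n. c *s v)"
    by (rule linearI) (auto simp: vec_eq_iff algebra_simps)
qed (simp add: norm_smult assms)

text \<open>Multiplication by \<open>cis x\<close> preserves Lebesgue measure and the norm, so the
  integral equals its average over rotations. With the order exchanged, the inner integral is the
  mean of g over a circle in the complex line through \<open>v\<close>, which is \<open>g 0\<close>
  whatever \<open>v\<close> is. Integrability against the Gaussian is the only growth
  condition.\<close>

lemma gaussian_mean_value:
  fixes g :: "complex ^ 'n::finite \<Rightarrow> complex"
  assumes g: "entire g" and a: "a > 0"
    and int: "integrable lborel (\<lambda>v. exp (- a * (norm v)\<^sup>2) *\<^sub>R g v)"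
  shows "(LINT v|lborel. exp (- a * (norm v)\<^sup>2) *\<^sub>R g v) = of_real ((pi / a) ^ CARD('n)) * g 0"
proof -
  define q where "q v = exp (- a * (norm v)\<^sup>2) *\<^sub>R g v" for v
  define F where "F x v = indicator {0..1} x *\<^sub>R q (cis (2 * pi * x) *s v)" for x :: real and v
  have con: "continuous_on A g" for A
    using entire_continuous[OF g] continuous_on_subset by blast
  have qm [measurable]: "q \<in> borel_measurable borel"
    unfolding q_def by (intro borel_measurable_continuous_onI continuous_intros con)
  have [measurable]: "(\<lambda>p::real \<times> (complex^'n). cis (2 * pi * fst p) *s snd p) \<in> borel_measurable (borel \<Otimes>\<^sub>M borel)"
    unfolding vector_scalar_mult_def borel_prod
    by (intro borel_measurable_continuous_onI continuous_intros)
  have meas: "(\<lambda>(x, v). F x v) \<in> borel_measurable (lborel \<Otimes>\<^sub>M lborel)"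
    unfolding F_def split_def by measurable
  have rot: "distr lborel borel (\<lambda>v. cis x *s v) = (lborel :: (complex ^ 'n) measure)" for x
    by (intro lborel_distr_isometry orthogonal_transformation_smult) simp
  have rotm: "(\<lambda>v::complex^'n. cis x *s v) \<in> borel_measurable borel" for x
    unfolding vector_scalar_mult_def by (intro borel_measurable_continuous_onI continuous_intros)
  have iq: "integrable lborel (\<lambda>v. q (cis x *s v))" for x
    using int integrable_distr_eq[OF _ qm, of "\<lambda>v. cis x *s v" lborel] rotm[of x]
    by (simp add: rot q_def[abs_def])
  have Iq: "(LINT v|lborel. q (cis x *s v)) = integral\<^sup>L lborel q" for x
    by (subst (2) rot[symmetric, of x], subst integral_distr) (use rotm in auto)
  have Inq: "(LINT v|lborel. norm (q (cis x *s v))) = (LINT v|lborel. norm (q v))" for x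
    by (subst (2) rot[symmetric, of x], subst integral_distr) (use rotm in auto)
  have intF: "integrable (lborel \<Otimes>\<^sub>M lborel) (\<lambda>(x, v). F x v)"
  proof (rule lborel_pair.Fubini_integrable[OF meas])
    have "(\<lambda>x. LINT v|lborel. norm (case (x, v) of (x, v) \<Rightarrow> F x v)) = (\<lambda>x. indicator {0..1} x * (LINT v|lborel. norm (q v)))"
      by (simp add: F_def Inq fun_eq_iff)
    then show "integrable lborel (\<lambda>x. LINT v|lborel. norm (case (x, v) of (x, v) \<Rightarrow> F x v))"
      by simp
    show "AE x in lborel. integrable lborel (\<lambda>v. case (x, v) of (x, v) \<Rightarrow> F x v)"
      using iq by (simp add: F_def)
  qed
  have "(LINT v|lborel. LINT x|lborel. F x v) = (LINT x|lborel. LINT v|lborel. F x v)"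
    using lborel_pair.Fubini_integral[OF intF] .
  also have "\<dots> = integral\<^sup>L lborel q"
    by (simp add: F_def Iq)
  finally have "integral\<^sup>L lborel q = (LINT v|lborel. LINT x|lborel. F x v)" by simp
  also have "\<dots> = (LINT v|(lborel :: (complex ^ 'n) measure). exp (- a * (norm v)\<^sup>2) *\<^sub>R g 0)"
  proof -
    have "(LINT x|lborel. F x v) = exp (- a * (norm v)\<^sup>2) *\<^sub>R (LBINT x:{0..1}. g (cis (2 * pi * x) *s v))" for v
      unfolding set_lebesgue_integral_def integral_scaleR_right[symmetric]
      by (simp add: F_def q_def norm_smult mult.commute)
    then show ?thesis
      by (simp add: holomorphic_circle_mean[OF entire_slice_holomorphic[OF g]])
  qed
  also have "\<dots> = of_real ((pi / a) ^ CARD('n)) * g 0"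
    using has_bochner_integral_gaussian[OF a, of "0 :: complex^'n"]
    by (simp add: has_bochner_integral_iff scaleR_conv_of_real)
  finally show ?thesis by (simp add: q_def[abs_def])
qed

section \<open>Gaussian measure in terms of Lebesgue measure\<close>

lemma measurable_lebesgue_borel: "f \<in> borel_measurable borel \<Longrightarrow> f \<in> borel_measurable lebesgue"
  by (rule measurable_completion) simp

lemma sets_gauss [measurable_cong, simp]: "sets (gauss t) = sets lebesgue"
  by (simp add: gauss_def)

lemma space_gauss [simp]: "space (gauss t) = UNIV"
  by (simp add: gauss_def)

lemma borel_measurable_gauss: "borel_measurable (gauss t) = borel_measurable lebesgue"
  by (rule measurable_cong_sets) simp_all

lemma gauss_density_measurable:
  "(\<lambda>z::complex ^ 'n::finite. 1 / (pi * t) ^ CARD('n) * exp (- (norm z)\<^sup>2 / t)) \<in> borel_measurable lebesgue"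
  by (intro measurable_lebesgue_borel) measurable

lemma integrable_gauss_iff:
  fixes g :: "complex ^ 'n::finite \<Rightarrow> 'b::{banach, second_countable_topology}"
  assumes t: "t > 0" and g: "g \<in> borel_measurable lebesgue"
  shows "integrable (gauss t) g \<longleftrightarrow> integrable lebesgue (\<lambda>z. exp (- (norm z)\<^sup>2 / t) *\<^sub>R g z)"
proof -
  have "integrable (gauss t) g \<longleftrightarrow>
      integrable lebesgue (\<lambda>z. (1 / (pi * t) ^ CARD('n)) *\<^sub>R (exp (- (norm z)\<^sup>2 / t) *\<^sub>R g z))"
    unfolding gauss_def using t
    by (subst integrable_density[OF g gauss_density_measurable]) auto
  also have "\<dots> \<longleftrightarrow> integrable lebesgue (\<lambda>z. exp (- (norm z)\<^sup>2 / t) *\<^sub>R g z)" (is "integrable _ (\<lambda>z. ?c *\<^sub>R ?G z) \<longleftrightarrow> _")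
  proof
    assume "integrable lebesgue (\<lambda>z. ?c *\<^sub>R ?G z)"
    from integrable_scaleR_right[OF this, of "inverse ?c"] show "integrable lebesgue ?G"
      using t by simp
  qed (rule integrable_scaleR_right)
  finally show ?thesis .
qed

lemma integral_gauss:
  fixes g :: "complex ^ 'n::finite \<Rightarrow> 'b::{banach, second_countable_topology}"
  assumes t: "t > 0" and g: "g \<in> borel_measurable lebesgue"
  shows "(LINT z|gauss t. g z) =
    (1 / (pi * t) ^ CARD('n)) *\<^sub>R (LINT z|lebesgue. exp (- (norm z)\<^sup>2 / t) *\<^sub>R g z)"
proof -
  have "(LINT z|gauss t. g z) = (LINT z|lebesgue. (1 / (pi * t) ^ CARD('n)) *\<^sub>R (exp (- (norm z)\<^sup>2 / t) *\<^sub>R g z))"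
    unfolding gauss_def using t
    by (subst integral_density[OF g gauss_density_measurable]) auto
  then show ?thesis by (simp only: integral_scaleR_right)
qed

lemma integrable_lborel_translate:
  fixes f :: "'a::euclidean_space \<Rightarrow> 'b::{banach, second_countable_topology}"
  assumes "f \<in> borel_measurable borel"
  shows "integrable lborel (\<lambda>x. f (c + x)) \<longleftrightarrow> integrable lborel f"
  using integrable_distr_eq[of "\<lambda>x. c + x" lborel borel f] assms by (simp add: lborel_distr_plus)

lemma integral_lborel_translate:
  fixes f :: "'a::euclidean_space \<Rightarrow> 'b::{banach, second_countable_topology}"
  assumes "f \<in> borel_measurable borel"
  shows "(LINT x|lborel. f (c + x)) = integral\<^sup>L lborel f"
  using integral_distr[of "\<lambda>x. c + x" lborel borel f] assms by (simp add: lborel_distr_plus)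

text \<open>The substitution \<open>w = u + v\<close> turns the reproducing formula at \<open>u\<close> into the Gaussian mean
  value property of the entire function \<open>v \<mapsto> h (u + v) exp (- hdot v u / t)\<close> at \<open>0\<close>.\<close>

lemma P_op_entire:
  fixes h :: "complex ^ 'n::finite \<Rightarrow> complex"
  assumes t: "t > 0" and h: "entire h" and int: "integrable (gauss t) (P_integrand t h u)"
  shows "P_op t h u = h u"
proof -
  define q where "q w = exp (- (norm w)\<^sup>2 / t) *\<^sub>R P_integrand t h u w" for w
  define g where "g v = h (u + v) * exp (hdot v (-u) / t)" for v
  have ch: "continuous_on A h" for A using entire_continuous[OF h] continuous_on_subset by blast
  have qb [measurable]: "q \<in> borel_measurable borel"
    unfolding q_def P_integrand_def using t
    by (intro borel_measurable_continuous_onI continuous_intros ch) auto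
  have Pb: "P_integrand t h u \<in> borel_measurable lebesgue"
    unfolding P_integrand_def using t
    by (intro measurable_lebesgue_borel borel_measurable_continuous_onI continuous_intros ch) auto
  have iq: "integrable lborel q"
    using int unfolding integrable_gauss_iff[OF t Pb] q_def[abs_def, symmetric]
    by (simp add: integrable_completion)
  have qg: "q (u + v) = exp (- (1 / t) * (norm v)\<^sup>2) *\<^sub>R g v" for v
  proof -
    have "hdot v (-u) = - hdot v u" using hdot_diff_right[of v 0 u] cnj_hdot[of 0 v] by (simp add: hdot_def sum_negf)
    \<comment> \<open>Of the four terms of the expanded square, \<open>hdot u u\<close> and
      \<open>hdot u v\<close> cancel against the kernel. The remaining mixed term
      \<open>hdot v u\<close> is linear in \<open>v\<close>, which keeps \<open>g\<close>
      entire.\<close>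
    then have "- of_real ((norm (u + v))\<^sup>2) / t + hdot u (u + v) / t = - of_real ((norm v)\<^sup>2) / t + hdot v (-u) / t"
      by (simp add: of_real_norm_sq hdot_add_left hdot_add_right add_divide_distrib diff_divide_distrib)
    then show ?thesis
      unfolding q_def g_def P_integrand_def
      by (simp add: scaleR_conv_of_real exp_of_real[symmetric] exp_add[symmetric] mult.left_commute[of _ "h (u + v)"])
  qed
  have eg: "entire g"
    unfolding g_def by (intro entire_mult entire_translate entire_exp_hdot h)
  have "integrable lborel (\<lambda>v. q (u + v))" using iq by (simp add: integrable_lborel_translate)
  then have "(LINT v|lborel. q (u + v)) = of_real ((pi * t) ^ CARD('n)) * g 0"
    unfolding qg using gaussian_mean_value[OF eg, of "1 / t"] t by simp
  also have "g 0 = h u" by (simp add: g_def)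
  finally have "integral\<^sup>L lborel q = of_real ((pi * t) ^ CARD('n)) * h u"
    by (simp add: integral_lborel_translate)
  then show ?thesis
    unfolding P_op_def integral_gauss[OF t Pb] q_def[abs_def, symmetric]
    using t by (simp add: integral_completion scaleR_conv_of_real)
qed

text \<open>With \<open>v = x + y\<close> the exponent splits into a constant, a Gaussian in y with
  parameter \<open>\<tau>\<close>, a term holomorphic in y and an antiholomorphic one. The
  antiholomorphic exponential is the kernel of \<open>P_op \<tau>\<close> at a suitable point
  \<open>u\<close>, so the integral is the reproduced value at \<open>u\<close> of the holomorphic
  exponential \<open>h\<close>.\<close>

lemma complex_gaussian_convolution:
  fixes x a b :: "complex ^ 'n::finite"
  assumes s: "s > 0" and r: "r > 0"
  shows "has_bochner_integral lebesgue
      (\<lambda>v. exp (- of_real ((norm (x - v))\<^sup>2 / s) - hdot (v - a) (v - b) / r))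
      (of_real ((pi * (s * r / (s + r))) ^ CARD('n)) * exp (- hdot (x - a) (x - b) / (s + r)))"
proof -
  define \<tau> where "\<tau> = s * r / (s + r)"
  define A where "A = x - a" define B where "B = x - b"
  \<comment> \<open>Solves \<open>hdot u y / \<tau> = - hdot A y / r\<close> for all y.\<close>
  define u where "u = (- \<tau> / r) *\<^sub>R A"
  define h where "h y = exp (hdot y (- B) / r)" for y :: "complex ^ 'n"
  have \<tau>: "\<tau> > 0" using s r by (simp add: \<tau>_def)
  have eh: "entire h" unfolding h_def by (rule entire_exp_hdot)
  have neg: "hdot y (- z) = - hdot y z" "hdot (- y) z = - hdot y z" for y z :: "complex ^ 'n"
    by (simp_all add: hdot_def sum_negf)
  define q where "q y = exp (- (norm y)\<^sup>2 / \<tau>) *\<^sub>R P_integrand \<tau> h u y" for y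
  define Q where "Q v = exp (- of_real ((norm (x - v))\<^sup>2 / s) - hdot (v - a) (v - b) / r)" for v
  have Pb: "P_integrand \<tau> h u \<in> borel_measurable borel"
    unfolding P_integrand_def h_def using \<tau> r
    by (intro borel_measurable_continuous_onI continuous_intros) auto
  have Pl: "P_integrand \<tau> h u \<in> borel_measurable lebesgue"
    using Pb by (rule measurable_lebesgue_borel)
  have qb: "q \<in> borel_measurable borel"
    unfolding q_def P_integrand_def h_def using \<tau> r
    by (intro borel_measurable_continuous_onI continuous_intros) auto
  have Qb: "Q \<in> borel_measurable borel"
    unfolding Q_def using s r
    by (intro borel_measurable_continuous_onI continuous_intros) auto
  have iq: "integrable lborel q"
  proof (rule integrable_gaussian_dominated[OF qb, of "1 / \<tau>" "norm B / r + norm u / \<tau>" 0])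
    fix y
    have "Re (hdot y (- B) / r) \<le> norm y * norm B / r"
      using r order_trans[OF complex_Re_le_cmod norm_hdot_le[of y "-B"]] by (simp add: divide_right_mono)
    moreover have "Re (hdot u y / \<tau>) \<le> norm u * norm y / \<tau>"
      using \<tau> order_trans[OF complex_Re_le_cmod norm_hdot_le[of u y]] by (simp add: divide_right_mono)
    ultimately show "norm (q y) \<le> exp (- (1 / \<tau>) * (norm y)\<^sup>2 + (norm B / r + norm u / \<tau>) * norm y + 0)"
      by (simp add: q_def P_integrand_def h_def norm_mult exp_add[symmetric] algebra_simps)
  qed (use \<tau> in simp)
  have "integrable (gauss \<tau>) (P_integrand \<tau> h u)"
    unfolding integrable_gauss_iff[OF \<tau> Pl] q_def[symmetric]
    using iq qb by (simp add: integrable_completion)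
  from P_op_entire[OF \<tau> eh this]
  have "integral\<^sup>L lborel q = of_real ((pi * \<tau>) ^ CARD('n)) * h u"
    unfolding P_op_def integral_gauss[OF \<tau> Pl] q_def[symmetric]
    using \<tau> qb by (simp add: integral_completion scaleR_conv_of_real field_simps)
  then have hq: "has_bochner_integral lborel q (of_real ((pi * \<tau>) ^ CARD('n)) * h u)"
    using iq by (simp add: has_bochner_integral_iff)
  have \<tau>r: "1 / \<tau> = 1 / s + 1 / r" using s r by (simp add: \<tau>_def field_simps)
  have Qq: "Q (x + y) = exp (- hdot A B / r) * q y" for y
  proof -
    have "- of_real ((norm (x - (x + y)))\<^sup>2 / s) - hdot ((x + y) - a) ((x + y) - b) / r =
       - hdot A B / r + (- of_real ((norm y)\<^sup>2) * of_real (1 / s + 1 / r) + (hdot y (- B) / r + hdot (- A) y / r))"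
    proof -
      have e: "x + y - a = A + y" "x + y - b = B + y" by (simp_all add: A_def B_def)
      show ?thesis unfolding e
        by (simp add: hdot_add_left hdot_add_right neg of_real_norm_sq ring_distribs add_divide_distrib)
    qed
    also have "hdot (- A) y / r = hdot u y / \<tau>"
      using \<tau> r by (simp add: u_def hdot_scaleR_left neg)
    finally show ?thesis
      unfolding Q_def q_def P_integrand_def h_def \<tau>r[symmetric]
      by (simp add: scaleR_conv_of_real exp_of_real[symmetric] exp_add[symmetric] algebra_simps)
  qed
  have "has_bochner_integral lborel (\<lambda>y. Q (x + y)) (exp (- hdot A B / r) * (of_real ((pi * \<tau>) ^ CARD('n)) * h u))"
    unfolding Qq by (intro has_bochner_integral_mult_right hq)
  \<comment> \<open>The reproduced value corrects the rate \<open>1 / r\<close> by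
    \<open>\<tau> / (r * r)\<close>, which leaves \<open>1 / (s + r)\<close>: this is the semigroup
    law for the parameters.\<close>
  moreover have "exp (- hdot A B / r) * h u = exp (- hdot A B / (s + r))"
  proof -
    have "- hdot A B / r + hdot u (- B) / r = - hdot A B * of_real (1 / r - \<tau> / (r * r))"
      by (simp add: u_def hdot_scaleR_left neg algebra_simps)
    also have "1 / r - \<tau> / (r * r) = 1 / (s + r)"
      using s r by (simp add: \<tau>_def divide_simps)
    finally show ?thesis by (simp add: h_def exp_add[symmetric])
  qed
  ultimately have "has_bochner_integral lborel (\<lambda>y. Q (x + y)) (of_real ((pi * \<tau>) ^ CARD('n)) * exp (- hdot A B / (s + r)))"
    by (simp add: mult.left_commute)
  then have "has_bochner_integral lborel Q (of_real ((pi * \<tau>) ^ CARD('n)) * exp (- hdot A B / (s + r)))"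
    using Qb by (simp add: has_bochner_integral_iff integrable_lborel_translate integral_lborel_translate)
  then show ?thesis
    using Qb by (simp add: has_bochner_integral_iff integrable_completion integral_completion \<tau>_def A_def B_def Q_def[abs_def])
qed

section \<open>Off-diagonal decay of the Berezin transform\<close>

text \<open>Comparison with a product of functions \<open>1 / (1 + x\<^sup>2)\<close>, one for each
  coordinate. Each of the \<open>DIM('a)\<close> factors needs its own
  \<open>exp (- 2 * norm u)\<close>, because \<open>1 + x\<^sup>2 \<le> (1 + norm u)\<^sup>2 \<le>
  exp (2 * norm u)\<close> for a coordinate x of u; hence the rate.\<close>

lemma integrable_exp_minus_norm:
  "integrable lborel (\<lambda>u::'a::euclidean_space. exp (- 2 * DIM('a) * norm u))"
proof (rule Bochner_Integration.integrable_bound)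
  let ?q = "\<lambda>x::real. inverse (1 + x\<^sup>2)"
  have "integrable lborel ?q"
    using integrable_inverse_1_plus_square by (simp add: set_integrable_def)
  then have fin: "(\<integral>\<^sup>+x. ennreal (?q x) \<partial>lborel) < \<infinity>"
    by (simp add: integrable_iff_bounded)
  show "integrable lborel (\<lambda>u::'a. \<Prod>b\<in>Basis. ?q (u \<bullet> b))"
  proof (rule integrableI_bounded)
    have "(\<integral>\<^sup>+u. ennreal (norm (\<Prod>b\<in>Basis. ?q (u \<bullet> b))) \<partial>(lborel :: 'a measure))
        = (\<integral>\<^sup>+u. (\<Prod>b\<in>Basis. ennreal (?q (u \<bullet> b))) \<partial>(lborel :: 'a measure))"
      by (simp add: prod_ennreal abs_prod)
    also have "\<dots> = (\<Prod>b\<in>(Basis :: 'a set). (\<integral>\<^sup>+x. ennreal (?q x) \<partial>lborel))"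
      by (rule nn_integral_lborel_prod) auto
    also have "\<dots> < \<infinity>" using fin by (simp add: power_less_top_ennreal)
    finally show "(\<integral>\<^sup>+u. ennreal (norm (\<Prod>b\<in>Basis. ?q (u \<bullet> b))) \<partial>(lborel :: 'a measure)) < \<infinity>" .
  qed simp
  have "exp (- 2 * DIM('a) * norm u) \<le> (\<Prod>b\<in>Basis. ?q (u \<bullet> b))" for u :: 'a
  proof -
    have "exp (- 2 * DIM('a) * norm u) = (\<Prod>b\<in>(Basis :: 'a set). exp (- 2 * norm u))"
      by (simp add: exp_of_nat_mult[symmetric] mult_ac)
    also have "\<dots> \<le> (\<Prod>b\<in>Basis. ?q (u \<bullet> b))"
    proof (intro prod_mono conjI)
      fix b :: 'a assume b: "b \<in> Basis"
      have "1 + (u \<bullet> b)\<^sup>2 \<le> (1 + norm u)\<^sup>2"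
        using power_mono[OF Basis_le_norm[OF b, of u], of 2] by (simp add: power2_sum add_increasing2)
      also have "\<dots> \<le> (exp (norm u))\<^sup>2"
        by (intro power_mono exp_ge_add_one_self) auto
      also have "\<dots> = exp (2 * norm u)" by (simp add: exp_double)
      finally have "inverse (exp (2 * norm u)) \<le> inverse (1 + (u \<bullet> b)\<^sup>2)"
        by (intro le_imp_inverse_le) (auto simp: add_pos_nonneg)
      then show "exp (- 2 * norm u) \<le> ?q (u \<bullet> b)" by (simp add: exp_minus)
    qed simp
    finally show ?thesis .
  qed
  then show "AE u in (lborel :: 'a measure). norm (exp (- 2 * DIM('a) * norm u)) \<le> norm (\<Prod>b\<in>Basis. ?q (u \<bullet> b))"
    by (intro always_eventually allI) (simp add: abs_prod order_trans[OF _ abs_ge_self])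
qed simp

text \<open>Trades radial growth for exponentials of linear forms, since the moduli of the kernels
  \<open>K t z\<close> are of that kind. The norm is at most the sum of the absolute coordinates, so
  the largest one is at least \<open>norm u / DIM('a)\<close>; the two signs replace its absolute
  value.\<close>

lemma exp_norm_le_sum_Basis:
  fixes u :: "'a::euclidean_space"
  assumes "M \<ge> 0"
  shows "exp (M * norm u) \<le> (\<Sum>b\<in>Basis. exp (M * DIM('a) * (u \<bullet> b)) + exp (- M * DIM('a) * (u \<bullet> b)))"
proof -
  have "\<exists>b\<in>Basis. norm u \<le> DIM('a) * \<bar>u \<bullet> b\<bar>"
  proof (rule ccontr)
    assume "\<not> ?thesis"
    then have "b \<in> Basis \<Longrightarrow> \<bar>u \<bullet> b\<bar> < norm u / DIM('a)" for b
      by (auto simp: not_le field_simps)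
    then have "(\<Sum>b\<in>Basis. \<bar>u \<bullet> b\<bar>) < (\<Sum>b\<in>(Basis :: 'a set). norm u / DIM('a))"
      by (intro sum_strict_mono) auto
    then show False using norm_le_l1[of u] by simp
  qed
  then obtain b where b: "b \<in> Basis" "norm u \<le> DIM('a) * \<bar>u \<bullet> b\<bar>" by blast
  have "exp (M * norm u) \<le> exp (M * DIM('a) * \<bar>u \<bullet> b\<bar>)"
    using mult_left_mono[OF b(2) assms] by (simp add: mult_ac)
  also have "\<dots> \<le> exp (M * DIM('a) * (u \<bullet> b)) + exp (- M * DIM('a) * (u \<bullet> b))"
    by (cases "u \<bullet> b \<ge> 0") (auto simp: add_increasing add_increasing2)
  also have "\<dots> \<le> (\<Sum>b\<in>Basis. exp (M * DIM('a) * (u \<bullet> b)) + exp (- M * DIM('a) * (u \<bullet> b)))"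
    by (rule member_le_sum[OF b(1)]) (auto intro: add_nonneg_nonneg)
  finally show ?thesis .
qed

lemma cmod_K: "cmod (K t z u) = exp ((u \<bullet> z) / t)"
  by (simp add: K_def Re_hdot)

text \<open>The hypothesis for all \<open>z\<close> puts \<open>f\<close> times every exponential weight into \<open>L\<^sup>2\<close>;
  one exponential factor is spent to pass from \<open>L\<^sup>2\<close> to \<open>L\<^sup>1\<close> by \<open>a b \<le> a\<^sup>2 + b\<^sup>2\<close>.\<close>

lemma integrable_exp_weight:
  fixes f :: "complex ^ 'n::finite \<Rightarrow> complex"
  assumes t: "t > 0" and f [measurable]: "f \<in> borel_measurable lebesgue"
    and fK: "\<And>z. (\<lambda>u. f u * K t z u) \<in> Lp_space (gauss t) 2" and N: "N \<ge> 0"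
  shows "integrable lebesgue (\<lambda>u. cmod (f u) * exp (N * norm u - (norm u)\<^sup>2 / (2 * t)))"
proof (rule Bochner_Integration.integrable_bound)
  have n [measurable]: "(norm :: complex ^ 'n \<Rightarrow> real) \<in> borel_measurable lebesgue"
    by (intro measurable_lebesgue_borel) simp
  define D where "D = real DIM(complex ^ 'n)"
  \<comment> \<open>The summand \<open>D\<close> compensates the factor
    \<open>exp (- D * norm u)\<close> split off below, whose square is integrable by
    \<open>integrable_exp_minus_norm\<close>; the 2 comes from squaring the other factor.\<close>
  define M where "M = 2 * (N + D)"
  have M: "M \<ge> 0" using N by (simp add: M_def D_def)
  have sq: "integrable lebesgue (\<lambda>u. (cmod (f u))\<^sup>2 * exp (2 * (u \<bullet> z) / t) * exp (- (norm u)\<^sup>2 / t))" for z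
  proof -
    have Km: "K t z \<in> borel_measurable lebesgue"
      unfolding K_def using t by (intro measurable_lebesgue_borel borel_measurable_continuous_onI continuous_intros) auto
    then have "(\<lambda>u. cmod (f u * K t z u) powr 2) \<in> borel_measurable lebesgue" by measurable
    then have "integrable lebesgue (\<lambda>u. exp (- (norm u)\<^sup>2 / t) *\<^sub>R (cmod (f u * K t z u) powr 2))"
      using fK[of z] integrable_gauss_iff[OF t, of "\<lambda>u. cmod (f u * K t z u) powr 2"]
      by (simp add: Lp_space_def)
    also have "(\<lambda>u. exp (- (norm u)\<^sup>2 / t) *\<^sub>R (cmod (f u * K t z u) powr 2)) =
        (\<lambda>u. (cmod (f u))\<^sup>2 * exp (2 * (u \<bullet> z) / t) * exp (- (norm u)\<^sup>2 / t))"
      by (simp add: fun_eq_iff norm_mult cmod_K power_mult_distrib exp_double[symmetric] mult_ac)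
    finally show ?thesis .
  qed
  \<comment> \<open>Scaled so that the squared moduli of the kernels at \<open>z b\<close> and
    \<open>- z b\<close> are the exponentials that \<open>exp_norm_le_sum_Basis\<close>
    produces.\<close>
  define z where "z b = (M * D * t / 2) *\<^sub>R b" for b :: "complex ^ 'n"
  have zb: "2 * (u \<bullet> z b) / t = M * D * (u \<bullet> b)" "2 * (u \<bullet> - z b) / t = - M * D * (u \<bullet> b)" for u b
    using t by (simp_all add: z_def)
  define S where "S u = (\<Sum>b\<in>Basis. (cmod (f u))\<^sup>2 * exp (2 * (u \<bullet> z b) / t) * exp (- (norm u)\<^sup>2 / t)
      + (cmod (f u))\<^sup>2 * exp (2 * (u \<bullet> - z b) / t) * exp (- (norm u)\<^sup>2 / t))" for u
  have "integrable lborel (\<lambda>u::complex ^ 'n. exp (- 2 * DIM(complex ^ 'n) * norm u))"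
    by (rule integrable_exp_minus_norm)
  then have "integrable lebesgue (\<lambda>u::complex ^ 'n. exp (- 2 * D * norm u))"
    unfolding D_def by (subst integrable_completion) auto
  then show "integrable lebesgue (\<lambda>u. S u + exp (- 2 * D * norm u))"
    unfolding S_def by (intro Bochner_Integration.integrable_add Bochner_Integration.integrable_sum sq) 
  show "(\<lambda>u. cmod (f u) * exp (N * norm u - (norm u)\<^sup>2 / (2 * t))) \<in> borel_measurable lebesgue"
    by measurable
  have "cmod (f u) * exp (N * norm u - (norm u)\<^sup>2 / (2 * t)) \<le> S u + exp (- 2 * D * norm u)" for u
  proof -
    define a where "a = cmod (f u) * exp ((N + D) * norm u - (norm u)\<^sup>2 / (2 * t))"
    define b where "b = exp (- D * norm u)"
    have ab0: "a \<ge> 0" "b \<ge> 0" by (simp_all add: a_def b_def)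
    have "cmod (f u) * exp (N * norm u - (norm u)\<^sup>2 / (2 * t)) = a * b"
      by (simp add: a_def b_def exp_add[symmetric] algebra_simps)
    also have "\<dots> \<le> a\<^sup>2 + b\<^sup>2"
      using sum_squares_bound[of a b] ab0 mult_nonneg_nonneg[of a b] by linarith
    also have "b\<^sup>2 = exp (- 2 * D * norm u)" by (simp add: b_def exp_double[symmetric] mult_ac)
    also have "a\<^sup>2 = (cmod (f u))\<^sup>2 * exp (M * norm u) * exp (- (norm u)\<^sup>2 / t)"
      using t by (simp add: a_def power_mult_distrib exp_double[symmetric] M_def exp_add[symmetric] algebra_simps)
    also have "\<dots> \<le> (cmod (f u))\<^sup>2 * (\<Sum>b\<in>Basis. exp (M * D * (u \<bullet> b)) + exp (- M * D * (u \<bullet> b))) * exp (- (norm u)\<^sup>2 / t)"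
      using exp_norm_le_sum_Basis[OF M, of u] unfolding D_def by (intro mult_right_mono mult_left_mono) auto
    also have "\<dots> = S u"
      unfolding S_def zb by (simp add: sum_distrib_left sum_distrib_right algebra_simps sum.distrib)
    finally show ?thesis by simp
  qed
  then show "AE u in lebesgue. norm (cmod (f u) * exp (N * norm u - (norm u)\<^sup>2 / (2 * t))) \<le> norm (S u + exp (- 2 * D * norm u))"
    by (intro always_eventually allI) (simp add: order_trans[OF _ abs_ge_self])
qed

text \<open>As f is only Lebesgue measurable, Fubini has to be applied over \<open>lebesgue\<close>,
  the completion of \<open>lborel\<close>.\<close>

lemma sigma_finite_completion:
  assumes "sigma_finite_measure M"
  shows "sigma_finite_measure (completion M)"
proof -
  obtain A :: "'a set set" where A: "countable A" "A \<subseteq> sets M" "\<Union>A = space M" "\<forall>a\<in>A. emeasure M a \<noteq> \<infinity>"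
    using sigma_finite_measure.sigma_finite_countable[OF assms] by blast
  show ?thesis
    by standard (use A in \<open>auto intro!: exI[of _ A] simp: emeasure_completion main_part_sets\<close>)
qed

interpretation lebesgue: sigma_finite_measure "lebesgue :: 'a::euclidean_space measure"
  by (rule sigma_finite_completion) (rule lborel.sigma_finite_measure_axioms)

interpretation lebesgue_pair: pair_sigma_finite
    "lebesgue :: 'a::euclidean_space measure" "lebesgue :: 'b::euclidean_space measure" ..

lemma borel_measurable_fst_lebesgue [measurable]:
    "fst \<in> borel_measurable ((lebesgue :: 'a::euclidean_space measure) \<Otimes>\<^sub>M N)"
  by (rule measurable_compose[OF measurable_fst], rule measurable_lebesgue_borel, simp)

lemma borel_measurable_snd_lebesgue [measurable]:
    "snd \<in> borel_measurable (N \<Otimes>\<^sub>M (lebesgue :: 'a::euclidean_space measure))"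
  by (rule measurable_compose[OF measurable_snd], rule measurable_lebesgue_borel, simp)

section \<open>The Berezin transform as a Gaussian integral\<close>

lemma sqrt_exp: "sqrt (exp x) = exp (x / 2)"
  by (rule real_sqrt_unique) (simp_all add: exp_double[symmetric])

lemma csqrt_K_self: "csqrt (K t z z) = of_real (exp ((norm z)\<^sup>2 / (2 * t)))"
proof -
  have "K t z z = of_real (exp ((norm z)\<^sup>2 / t))"
    by (simp add: K_def hdot_self exp_of_real[symmetric])
  then show ?thesis
    by (simp add: of_real_sqrt[symmetric] sqrt_exp del: csqrt_of_real_nonneg)
qed

lemma nK_eq: "nK t z u = K t z u * of_real (exp (- (norm z)\<^sup>2 / (2 * t)))"
proof -
  have e: "exp (- (norm z)\<^sup>2 / (2 * t)) = inverse (exp ((norm z)\<^sup>2 / (2 * t)))"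
    unfolding exp_minus[symmetric] minus_divide_left ..
  show ?thesis
    unfolding nK_def csqrt_K_self e of_real_inverse divide_inverse[of "K t z u"] ..
qed

lemma berezin_eq:
  "berezin t f z w = of_real (exp (- ((norm z)\<^sup>2 + (norm w)\<^sup>2) / (2 * t))) *
     (LINT u|gauss t. f u * exp ((hdot u z + hdot w u) / t))"
proof -
  have "f u * nK t z u * cnj (nK t w u) =
      of_real (exp (- ((norm z)\<^sup>2 + (norm w)\<^sup>2) / (2 * t))) * (f u * exp ((hdot u z + hdot w u) / t))" for u
  proof -
    have "exp (- ((norm z)\<^sup>2 + (norm w)\<^sup>2) / (2 * t)) = exp (- (norm z)\<^sup>2 / (2 * t)) * exp (- (norm w)\<^sup>2 / (2 * t))"
      by (simp add: exp_add[symmetric] diff_divide_distrib)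
    moreover have "exp ((hdot u z + hdot w u) / t) = K t z u * cnj (K t w u)"
      by (simp add: K_def exp_cnj cnj_hdot exp_add[symmetric] add_divide_distrib)
    ultimately show ?thesis by (simp add: nK_eq)
  qed
  then show ?thesis
    unfolding berezin_def inner_t_def by (simp only: integral_mult_right_zero)
qed

lemma borel_measurable_mult_continuous:
  fixes f q :: "'a::euclidean_space \<Rightarrow> complex"
  assumes "f \<in> borel_measurable lebesgue" "continuous_on UNIV q"
  shows "(\<lambda>u. f u * q u) \<in> borel_measurable lebesgue"
  by (intro borel_measurable_times assms(1) measurable_lebesgue_borel[of q] borel_measurable_continuous_onI assms(2))

text \<open>Multiplied out, \<open>hdot (u - a) (u - b)\<close> consists of the exponents of the
  Gaussian density and of the two kernels, and the constant \<open>hdot a b\<close>. Off the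
  diagonal, f is therefore integrated against the Gaussian with its squared distance
  polarised.\<close>

lemma berezin_eq_lebesgue:
  fixes a b :: "complex ^ 'n::finite"
  assumes t: "t > 0" and f: "f \<in> borel_measurable lebesgue"
  shows "berezin t f b a =
     of_real (1 / (pi * t) ^ CARD('n)) * exp (hdot a b / t - of_real (((norm b)\<^sup>2 + (norm a)\<^sup>2) / (2 * t))) *
     (LINT u|lebesgue. f u * exp (- hdot (u - a) (u - b) / t))"
proof -
  have m: "(\<lambda>u. f u * exp ((hdot u b + hdot a u) / t)) \<in> borel_measurable lebesgue"
    using t by (intro borel_measurable_mult_continuous f continuous_intros) auto
  have e: "exp (- (norm u)\<^sup>2 / t) *\<^sub>R (f u * exp ((hdot u b + hdot a u) / t)) =
      exp (hdot a b / t) * (f u * exp (- hdot (u - a) (u - b) / t))" for u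
  proof -
    have "- hdot (u - a) (u - b) / t = - of_real ((norm u)\<^sup>2) / t + (hdot u b + hdot a u) / t - hdot a b / t"
      by (simp add: of_real_norm_sq hdot_diff_left hdot_diff_right diff_divide_distrib add_divide_distrib)
    then have x: "- of_real ((norm u)\<^sup>2) / t + (hdot u b + hdot a u) / t = hdot a b / t + - hdot (u - a) (u - b) / t"
      by simp
    have "exp (- (norm u)\<^sup>2 / t) *\<^sub>R (f u * exp ((hdot u b + hdot a u) / t)) =
        f u * exp (- of_real ((norm u)\<^sup>2) / t + (hdot u b + hdot a u) / t)"
      by (simp add: scaleR_conv_of_real exp_of_real[symmetric] mult.left_commute[of _ "f u"] exp_add[symmetric])
    also have "\<dots> = exp (hdot a b / t) * (f u * exp (- hdot (u - a) (u - b) / t))"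
      unfolding x exp_add by (rule mult.left_commute)
    finally show ?thesis .
  qed
  have "of_real (exp (- A / (2 * t))) * (c *\<^sub>R (exp h * J)) = of_real c * exp (h - of_real (A / (2 * t))) * J"
    for A c and h J :: complex
  proof -
    have "exp (h - of_real (A / (2 * t))) = exp h * of_real (exp (- A / (2 * t)))"
      by (simp add: exp_of_real[symmetric] exp_add[symmetric])
    then show ?thesis by (simp add: scaleR_conv_of_real)
  qed
  then show ?thesis
    unfolding berezin_eq integral_gauss[OF t m] e integral_mult_right_zero .
qed

text \<open>On the diagonal the exponent of the prefactor vanishes, and what remains is a heat flow:
  f convolved with a Gaussian of mass one.\<close>

lemma berezin_diag_eq:
  fixes v :: "complex ^ 'n::finite"
  assumes "s > 0" and "f \<in> borel_measurable lebesgue"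
  shows "berezin_diag s f v =
     of_real (1 / (pi * s) ^ CARD('n)) * (LINT u|lebesgue. f u * of_real (exp (- (norm (u - v))\<^sup>2 / s)))"
proof -
  have "hdot v v / s - of_real (((norm v)\<^sup>2 + (norm v)\<^sup>2) / (2 * s)) = 0"
    using assms by (simp add: hdot_self field_simps)
  moreover have "exp (- hdot (u - v) (u - v) / s) = of_real (exp (- (norm (u - v))\<^sup>2 / s))" for u
    by (simp add: hdot_self exp_of_real[symmetric])
  ultimately show ?thesis
    unfolding berezin_diag_def berezin_eq_lebesgue[OF assms] by (simp only: exp_zero mult_1_right)
qed

text \<open>Polarisation about the midpoint. The negative term is the source of the growth
  \<open>exp ((norm (a - b))\<^sup>2 / (4 * r))\<close>; apart from it, the polarised Gaussian has
  the modulus of a true one centred at the midpoint.\<close>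

lemma Re_hdot_diff:
  fixes v a b :: "complex ^ 'n::finite"
  shows "Re (hdot (v - a) (v - b)) = (norm (v - (1/2) *\<^sub>R (a + b)))\<^sup>2 - (norm (a - b))\<^sup>2 / 4"
  unfolding Re_hdot power2_norm_eq_inner
  by (simp add: inner_simps inner_commute field_simps)

text \<open>The case in which \<open>a\<close> and \<open>b\<close> coincide and everything is real;
  it evaluates the absolute values that Fubini asks for.\<close>

lemma has_bochner_integral_gaussian_convolution:
  fixes x m :: "complex ^ 'n::finite"
  assumes s: "s > 0" and r: "r > 0"
  shows "has_bochner_integral lebesgue
      (\<lambda>v. exp (- (norm (x - v))\<^sup>2 / s - (norm (v - m))\<^sup>2 / r))
      ((pi * (s * r / (s + r))) ^ CARD('n) * exp (- (norm (x - m))\<^sup>2 / (s + r)))"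
proof -
  have "has_bochner_integral lebesgue
      (\<lambda>v. complex_of_real (exp (- (norm (x - v))\<^sup>2 / s - (norm (v - m))\<^sup>2 / r)))
      (complex_of_real ((pi * (s * r / (s + r))) ^ CARD('n) * exp (- (norm (x - m))\<^sup>2 / (s + r))))"
    using complex_gaussian_convolution[OF s r, of x m m]
    by (simp add: exp_of_real[symmetric] hdot_self)
  from has_bochner_integral_bounded_linear[OF bounded_linear_Re this] show ?thesis
    by simp
qed

lemma sup_norm_ge: "bounded (range g) \<Longrightarrow> cmod (g z) \<le> sup_norm g"
  unfolding sup_norm_def
  by (rule cSUP_upper) (auto simp: bounded_iff bdd_above_def)

lemma sup_norm_nonneg: "bounded (range g) \<Longrightarrow> 0 \<le> sup_norm g"
  by (rule order_trans[OF norm_ge_zero sup_norm_ge])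

lemma norm_complex_gaussian:
  fixes v a b :: "complex ^ 'n::finite"
  shows "cmod (exp (- hdot (v - a) (v - b) / of_real r)) =
    exp ((norm (a - b))\<^sup>2 / (4 * r)) * exp (- (norm (v - (1/2) *\<^sub>R (a + b)))\<^sup>2 / r)"
proof -
  have "Re (- hdot (v - a) (v - b) / of_real r) = (norm (a - b))\<^sup>2 / (4 * r) + (- (norm (v - (1/2) *\<^sub>R (a + b)))\<^sup>2 / r)"
    by (simp add: Re_hdot_diff diff_divide_distrib)
  then show ?thesis by (simp only: norm_exp_eq_Re exp_add)
qed

text \<open>The double integral of \<open>\<Phi>\<close> is evaluated in both orders. Over v first,
  the Gaussians with parameters \<open>s\<close> and \<open>r\<close> merge into the polarised one
  with parameter \<open>t\<close>, which gives the integral to be estimated. Over x first, the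
  values of \<open>berezin_diag s f\<close> appear against \<open>k\<close>; they are replaced by
  their supremum, and the modulus of \<open>k\<close> has total mass
  \<open>E * (pi * r) ^ CARD('n)\<close>.\<close>

lemma gaussian_integral_bound:
  fixes a b :: "complex ^ 'n::finite"
  assumes t: "t > 0" and s: "0 < s" "s < t" and f [measurable]: "f \<in> borel_measurable lebesgue"
    and w: "\<And>N. N \<ge> 0 \<Longrightarrow> integrable lebesgue (\<lambda>u. cmod (f u) * exp (N * norm u - (norm u)\<^sup>2 / (2 * t)))"
    and bd: "bounded (range (berezin_diag s f))"
  shows "cmod (LINT u|lebesgue. f u * exp (- hdot (u - a) (u - b) / t)) \<le>
    (pi * t) ^ CARD('n) * sup_norm (berezin_diag s f) * exp ((norm (a - b))\<^sup>2 / (4 * (t - s)))"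
proof -
  define r where "r = t - s"
  define m where "m = (1/2) *\<^sub>R (a + b)"
  define E where "E = exp ((norm (a - b))\<^sup>2 / (4 * r))"
  define c where "c = (pi * (s * r / t)) ^ CARD('n)"
  have r: "r > 0" and srt: "s + r = t" using s by (simp_all add: r_def)
  have c: "c > 0" using r s t by (simp add: c_def)
  define k where "k v = exp (- hdot (v - a) (v - b) / of_real r)" for v
  define \<Phi> where "\<Phi> x v = f x * (of_real (exp (- (norm (x - v))\<^sup>2 / s)) * k v)" for x v
  have km: "cmod (k v) = E * exp (- (norm (v - m))\<^sup>2 / r)" for v
    unfolding k_def norm_complex_gaussian E_def m_def ..
  have meas: "(\<lambda>(x, v). \<Phi> x v) \<in> borel_measurable (lebesgue \<Otimes>\<^sub>M lebesgue)"
    unfolding \<Phi>_def k_def split_def by measurable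
  have norm\<Phi>: "cmod (\<Phi> x v) = cmod (f x) * E * exp (- (norm (x - v))\<^sup>2 / s - (norm (v - m))\<^sup>2 / r)" for x v
    by (simp add: \<Phi>_def norm_mult km exp_add[symmetric] algebra_simps)
  note conv = has_bochner_integral_gaussian_convolution[where 'n='n, OF s(1) r, unfolded srt, folded c_def]
  have inner: "(LINT v|lebesgue. cmod (\<Phi> x v)) = c * E * (cmod (f x) * exp (- (norm (x - m))\<^sup>2 / t))" for x
    unfolding norm\<Phi>
    using has_bochner_integral_integral_eq[OF has_bochner_integral_mult_right[OF conv, of "cmod (f x) * E" x m]]
    by (simp only: mult_ac)
  have eq_t: "complex_of_real s + complex_of_real r = complex_of_real t" by (simp add: srt[symmetric])
  have ccv: "has_bochner_integral lebesgue (\<Phi> x) (f x * (of_real c * exp (- hdot (x - a) (x - b) / of_real t)))" for x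
  proof -
    have "of_real (exp (- (norm (x - v))\<^sup>2 / s)) * k v = exp (- of_real ((norm (x - v))\<^sup>2 / s) - hdot (v - a) (v - b) / of_real r)" for v
      by (simp add: k_def exp_of_real[symmetric] exp_add[symmetric])
    then show ?thesis
      unfolding \<Phi>_def
      using has_bochner_integral_mult_right[OF complex_gaussian_convolution[OF s(1) r, of x a b], of "f x"]
      unfolding srt eq_t c_def[symmetric] by (simp only:)
  qed
  have int: "integrable (lebesgue \<Otimes>\<^sub>M lebesgue) (\<lambda>(x, v). \<Phi> x v)"
  proof (rule lebesgue_pair.Fubini_integrable[OF meas])
    \<comment> \<open>Moving the centre from \<open>m\<close> to the origin costs the linear
      exponent \<open>2 * norm m / t * norm x\<close>, and giving up half of the quadratic rate
      leads to the weight in assumption \<open>w\<close>.\<close>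
    have "integrable lebesgue (\<lambda>x. cmod (f x) * exp (- (norm (x - m))\<^sup>2 / t))"
    proof (rule Bochner_Integration.integrable_bound[OF w[of "2 * norm m / t"]])
      show "(\<lambda>x. cmod (f x) * exp (- (norm (x - m))\<^sup>2 / t)) \<in> borel_measurable lebesgue"
        by (intro borel_measurable_times measurable_lebesgue_borel[of "\<lambda>x. exp (- (norm (x - m))\<^sup>2 / t)"]) measurable
      have "- (norm (x - m))\<^sup>2 / t \<le> 2 * norm m / t * norm x - (norm x)\<^sup>2 / (2 * t)" for x
      proof -
        have "(norm (x - m))\<^sup>2 \<ge> (norm x)\<^sup>2 - 2 * (norm m * norm x)"
        proof -
          have "(norm (x - m))\<^sup>2 = (norm x)\<^sup>2 - 2 * (x \<bullet> m) + (norm m)\<^sup>2"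
            by (simp add: power2_norm_eq_inner inner_simps inner_commute)
          then show ?thesis
            using norm_cauchy_schwarz[of x m] zero_le_power2[of "norm m"]
            unfolding mult.commute[of "norm m"] by linarith
        qed
        then have "- (norm (x - m))\<^sup>2 / t \<le> (2 * (norm m * norm x) - (norm x)\<^sup>2) / t"
          using t by (intro divide_right_mono) auto
        also have "\<dots> \<le> 2 * norm m / t * norm x - (norm x)\<^sup>2 / (2 * t)"
          using t by (simp add: field_simps)
        finally show ?thesis .
      qed
      then show "AE x in lebesgue. norm (cmod (f x) * exp (- (norm (x - m))\<^sup>2 / t)) \<le>
          norm (cmod (f x) * exp (2 * norm m / t * norm x - (norm x)\<^sup>2 / (2 * t)))"
        by (intro always_eventually allI) (simp add: abs_mult mult_left_mono)
    qed (use t in simp)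
    then show "integrable lebesgue (\<lambda>x. LINT v|lebesgue. norm (case (x, v) of (x, v) \<Rightarrow> \<Phi> x v))"
      by (simp add: inner)
    show "AE x in lebesgue. integrable lebesgue (\<lambda>v. case (x, v) of (x, v) \<Rightarrow> \<Phi> x v)"
      using ccv by (simp add: has_bochner_integral_iff)
  qed
  define H where "H = berezin_diag s f"
  have inner2: "(LINT x|lebesgue. \<Phi> x v) = of_real ((pi * s) ^ CARD('n)) * H v * k v" for v
    unfolding \<Phi>_def mult.assoc[symmetric] H_def berezin_diag_eq[OF s(1) f] using s by simp
  have iHk: "integrable lebesgue (\<lambda>v. of_real ((pi * s) ^ CARD('n)) * H v * k v)"
    using lebesgue_pair.integrable_snd[OF int] by (simp add: inner2)
  have hb: "has_bochner_integral lebesgue (\<lambda>v. exp (- (1 / r) * (norm (v - m))\<^sup>2)) ((pi * r) ^ CARD('n))"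
    using has_bochner_integral_gaussian[of "1 / r" m] r by (simp add: has_bochner_integral_iff integrable_completion integral_completion)
  have "of_real c * (LINT x|lebesgue. f x * exp (- hdot (x - a) (x - b) / of_real t)) = (LINT x|lebesgue. LINT v|lebesgue. \<Phi> x v)"
    unfolding has_bochner_integral_integral_eq[OF ccv] mult.left_commute[of "f _"] integral_mult_right_zero ..
  also have "\<dots> = (LINT v|lebesgue. LINT x|lebesgue. \<Phi> x v)"
    using lebesgue_pair.Fubini_integral[OF int] by simp
  also have "\<dots> = (LINT v|lebesgue. of_real ((pi * s) ^ CARD('n)) * H v * k v)"
    by (simp add: inner2)
  finally have "cmod (of_real c * (LINT x|lebesgue. f x * exp (- hdot (x - a) (x - b) / of_real t))) =
      cmod (LINT v|lebesgue. of_real ((pi * s) ^ CARD('n)) * H v * k v)"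
    by (rule arg_cong)
  then have step1: "c * cmod (LINT x|lebesgue. f x * exp (- hdot (x - a) (x - b) / of_real t)) =
      cmod (LINT v|lebesgue. of_real ((pi * s) ^ CARD('n)) * H v * k v)"
    using c unfolding norm_mult by simp
  also have "\<dots> \<le> (LINT v|lebesgue. ((pi * s) ^ CARD('n) * sup_norm H * E) * exp (- (1 / r) * (norm (v - m))\<^sup>2))"
  proof (rule Bochner_Integration.integral_norm_bound_integral[OF iHk])
    show "integrable lebesgue (\<lambda>v. ((pi * s) ^ CARD('n) * sup_norm H * E) * exp (- (1 / r) * (norm (v - m))\<^sup>2))"
      by (intro integrable_mult_right) (use hb in \<open>auto simp: has_bochner_integral_iff\<close>)
    show "cmod (of_real ((pi * s) ^ CARD('n)) * H v * k v) \<le> ((pi * s) ^ CARD('n) * sup_norm H * E) * exp (- (1 / r) * (norm (v - m))\<^sup>2)" for v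
    proof -
      have "cmod (of_real ((pi * s) ^ CARD('n)) * H v * k v) = (pi * s) ^ CARD('n) * cmod (H v) * (E * exp (- (1 / r) * (norm (v - m))\<^sup>2))"
        unfolding norm_mult km norm_of_real using s by simp
      also have "\<dots> \<le> (pi * s) ^ CARD('n) * sup_norm H * (E * exp (- (1 / r) * (norm (v - m))\<^sup>2))"
        using sup_norm_ge[OF bd, of v] s by (intro mult_right_mono mult_left_mono) (auto simp: H_def E_def)
      finally show ?thesis by (simp only: mult.assoc)
    qed
  qed
  also have "\<dots> = (pi * s) ^ CARD('n) * sup_norm H * E * (pi * r) ^ CARD('n)"
    unfolding integral_mult_right_zero has_bochner_integral_integral_eq[OF hb] ..
  also have "\<dots> = c * ((pi * t) ^ CARD('n) * sup_norm H * E)"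
  proof -
    \<comment> \<open>The masses on the two sides match, so \<open>E\<close> is the only loss in the
      estimate.\<close>
    have ct: "c * (pi * t) ^ CARD('n) = (pi * s) ^ CARD('n) * (pi * r) ^ CARD('n)"
      unfolding c_def power_mult_distrib[symmetric] using t by (simp add: mult_ac)
    have "(pi * s) ^ CARD('n) * sup_norm H * E * (pi * r) ^ CARD('n) = ((pi * s) ^ CARD('n) * (pi * r) ^ CARD('n)) * (sup_norm H * E)"
      by (simp only: mult_ac)
    also have "\<dots> = c * (pi * t) ^ CARD('n) * (sup_norm H * E)"
      by (simp only: ct)
    finally show ?thesis by (simp only: mult_ac)
  qed
  finally show ?thesis using c by (simp add: H_def E_def r_def)
qed

text \<open>The prefactor in \<open>berezin_eq_lebesgue\<close> has modulus
  \<open>exp (- (norm (a - b))\<^sup>2 / (2 * t))\<close> up to the normalising constant. Set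
  against the growth in \<open>gaussian_integral_bound\<close> it yields the difference of the two
  rates.\<close>

lemma berezin_off_diagonal_bound:
  fixes a b :: "complex ^ 'n::finite"
  assumes t: "t > 0" and s: "0 < s" "s < t" and f: "f \<in> borel_measurable lebesgue"
    and w: "\<And>N. N \<ge> 0 \<Longrightarrow> integrable lebesgue (\<lambda>u. cmod (f u) * exp (N * norm u - (norm u)\<^sup>2 / (2 * t)))"
    and bd: "bounded (range (berezin_diag s f))"
  shows "cmod (berezin t f b a) \<le>
    sup_norm (berezin_diag s f) * exp (- (1 / (2 * t) - 1 / (4 * (t - s))) * (norm (a - b))\<^sup>2)"
proof -
  let ?J = "LINT u|lebesgue. f u * exp (- hdot (u - a) (u - b) / t)"
  have "Re (hdot a b / t - of_real (((norm b)\<^sup>2 + (norm a)\<^sup>2) / (2 * t))) = - (norm (a - b))\<^sup>2 / (2 * t)"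
  proof -
    have "a \<bullet> b = ((norm b)\<^sup>2 + (norm a)\<^sup>2 - (norm (a - b))\<^sup>2) / 2"
      unfolding power2_norm_eq_inner by (simp add: inner_simps inner_commute)
    then show ?thesis by (simp add: Re_hdot add_divide_distrib diff_divide_distrib)
  qed
  then have "cmod (berezin t f b a) = exp (- (norm (a - b))\<^sup>2 / (2 * t)) * (cmod ?J / (pi * t) ^ CARD('n))"
    unfolding berezin_eq_lebesgue[OF t f] norm_mult norm_exp_eq_Re using t by (simp add: norm_divide norm_power norm_mult)
  also have "\<dots> \<le> exp (- (norm (a - b))\<^sup>2 / (2 * t)) * (sup_norm (berezin_diag s f) * exp ((norm (a - b))\<^sup>2 / (4 * (t - s))))"
  proof (rule mult_left_mono)
    have "cmod ?J \<le> sup_norm (berezin_diag s f) * exp ((norm (a - b))\<^sup>2 / (4 * (t - s))) * (pi * t) ^ CARD('n)"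
      using gaussian_integral_bound[OF t s f w bd, of a b] by (simp only: mult_ac)
    then show "cmod ?J / (pi * t) ^ CARD('n) \<le> sup_norm (berezin_diag s f) * exp ((norm (a - b))\<^sup>2 / (4 * (t - s)))"
      using t by (subst pos_divide_le_eq) auto
  qed simp
  also have "\<dots> = sup_norm (berezin_diag s f) * exp (- (1 / (2 * t) - 1 / (4 * (t - s))) * (norm (a - b))\<^sup>2)"
    by (simp only: mult.left_commute exp_add[symmetric] left_diff_distrib minus_diff_eq) (simp add: diff_divide_distrib)
  finally show ?thesis .
qed

section \<open>The integral operator as a composition of projections\<close>

lemma finite_measure_gauss:
  assumes "t > 0"
  shows "finite_measure (gauss t :: (complex ^ 'n::finite) measure)"
proof (rule finite_measureI)
  have "integrable lebesgue (\<lambda>z::complex ^ 'n. 1 / (pi * t) ^ CARD('n) * exp (- (norm z)\<^sup>2 / t))"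
  proof (rule integrable_mult_right)
    show "integrable lebesgue (\<lambda>z::complex ^ 'n. exp (- (norm z)\<^sup>2 / t))"
      using has_bochner_integral_gaussian[of "1 / t" "0 :: complex ^ 'n"] assms
      by (simp add: has_bochner_integral_iff integrable_completion)
  qed
  then have "(\<integral>\<^sup>+z. ennreal (norm (1 / (pi * t) ^ CARD('n) * exp (- (norm z)\<^sup>2 / t))) \<partial>(lebesgue :: (complex ^ 'n) measure)) < \<infinity>"
    by (simp only: integrable_iff_bounded)
  then show "emeasure (gauss t :: (complex ^ 'n) measure) (space (gauss t)) \<noteq> \<infinity>"
    unfolding gauss_def using assms gauss_density_measurable[of t, where 'n='n]
    by (subst emeasure_density) auto
qed

lemma sigma_finite_gauss: "t > 0 \<Longrightarrow> sigma_finite_measure (gauss t)"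
  using finite_measure.axioms(1)[OF finite_measure_gauss] .

lemma borel_measurable_fst_gauss [measurable]: "fst \<in> borel_measurable (gauss t \<Otimes>\<^sub>M N)"
  by (rule measurable_compose[OF measurable_fst])
     (simp add: borel_measurable_gauss measurable_lebesgue_borel)

lemma borel_measurable_snd_gauss [measurable]: "snd \<in> borel_measurable (N \<Otimes>\<^sub>M gauss t)"
  by (rule measurable_compose[OF measurable_snd])
     (simp add: borel_measurable_gauss measurable_lebesgue_borel)

lemma borel_measurable_id_gauss [measurable]: "(\<lambda>x. x) \<in> borel_measurable (gauss t)"
  by (simp add: borel_measurable_gauss measurable_lebesgue_borel)

lemma integrable_exp_bounded:
  fixes \<phi> q :: "complex ^ 'n::finite \<Rightarrow> complex"
  assumes \<phi>: "\<phi> \<in> borel_measurable M" and q: "q \<in> borel_measurable M"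
    and int: "integrable M (\<lambda>u. cmod (\<phi> u) * exp (N * norm u))"
    and bound: "\<And>u. cmod (q u) \<le> exp (N * norm u)"
  shows "integrable M (\<lambda>u. \<phi> u * q u)"
  using int by (rule Bochner_Integration.integrable_bound)
     (use \<phi> q bound in \<open>auto simp: norm_mult intro!: mult_left_mono always_eventually\<close>)

text \<open>Differentiation under the integral sign with a quantitative remainder. The second-order
  Taylor estimate of the exponential is dominated by an exponential of the norm and hence integrable
  by assumption, uniformly for y within distance 1 of z. This gives joint differentiability at once,
  rather than one coordinate at a time.\<close>

lemma P_op_has_derivative:
  fixes \<phi> :: "complex ^ 'n::finite \<Rightarrow> complex"
  assumes t: "t > 0" and \<phi> [measurable]: "\<phi> \<in> borel_measurable (gauss t)"
    and int: "\<And>N. N \<ge> 0 \<Longrightarrow> integrable (gauss t) (\<lambda>u. cmod (\<phi> u) * exp (N * norm u))"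
  shows "(P_op t \<phi> has_derivative
    (\<lambda>v. LINT u|gauss t. \<phi> u * (hdot v u / t * exp (hdot z u / t)))) (at z)"
proof (rule has_derivativeI_sandwich[where e = 1])
  let ?D = "\<lambda>v. LINT u|gauss t. \<phi> u * (hdot v u / t * exp (hdot z u / t))"
  define x where "x u = norm u / t" for u :: "complex ^ 'n"
  have x0: "x u \<ge> 0" for u using t by (simp add: x_def)
  have xexp: "x u \<le> exp (x u)" for u using exp_ge_add_one_self[of "x u"] by linarith
  have hx: "cmod (hdot v u / t) \<le> norm v * x u" for u v
    using norm_hdot_le[of v u] t by (simp add: x_def norm_divide divide_right_mono)
  have ex: "cmod (exp (hdot v u / t)) \<le> exp (norm v * x u)" for u v
    using order_trans[OF complex_Re_le_cmod hx[of v u]] by (simp add: norm_exp_eq_Re)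
  have xN: "exp (c * x u) = exp (c / t * norm u)" for c u by (simp add: x_def)
  have i0: "integrable (gauss t) (\<lambda>u. \<phi> u * exp (hdot v u / t))" for v
  proof (rule integrable_exp_bounded[OF \<phi>])
    show "integrable (gauss t) (\<lambda>u. cmod (\<phi> u) * exp (norm v / t * norm u))"
      using t by (intro int) simp
    show "cmod (exp (hdot v u / t)) \<le> exp (norm v / t * norm u)" for u
      using ex[of v u] by (simp only: xN)
  qed measurable
  have dbound: "cmod (hdot v u / t * exp (hdot z u / t)) \<le> norm v * exp ((norm z + 1) / t * norm u)" for u v
  proof -
    have "cmod (hdot v u / t * exp (hdot z u / t)) \<le> (norm v * exp (x u)) * exp (norm z * x u)"
      unfolding norm_mult using hx[of v u] ex[of z u] xexp[of u]
      by (intro mult_mono order_trans[OF hx] mult_left_mono) auto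
    also have "\<dots> = norm v * exp ((norm z + 1) * x u)"
      by (simp add: exp_add[symmetric] algebra_simps)
    finally show ?thesis by (simp only: xN)
  qed
  have iz: "integrable (gauss t) (\<lambda>u. cmod (\<phi> u) * exp ((norm z + 1) / t * norm u))"
    using t by (intro int) simp
  have i1: "integrable (gauss t) (\<lambda>u. \<phi> u * (hdot v u / t * exp (hdot z u / t)))" for v
  proof (rule Bochner_Integration.integrable_bound[OF integrable_mult_right[OF iz, of "norm v"]])
    show "(\<lambda>u. \<phi> u * (hdot v u / t * exp (hdot z u / t))) \<in> borel_measurable (gauss t)" by measurable
    show "AE u in gauss t. norm (\<phi> u * (hdot v u / t * exp (hdot z u / t))) \<le>
        norm (norm v * (cmod (\<phi> u) * exp ((norm z + 1) / t * norm u)))"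
    proof (intro always_eventually allI)
      fix u
      show "norm (\<phi> u * (hdot v u / t * exp (hdot z u / t))) \<le>
        norm (norm v * (cmod (\<phi> u) * exp ((norm z + 1) / t * norm u)))"
        using mult_left_mono[OF dbound[of v u], of "cmod (\<phi> u)"]
        by (simp only: norm_mult abs_mult norm_of_real real_norm_def abs_norm_cancel abs_exp_cancel mult.left_commute norm_ge_zero)
    qed
  qed
  show "bounded_linear ?D"
  proof (rule bounded_linear_intro)
    fix v w r
    show "?D (v + w) = ?D v + ?D w"
      by (subst Bochner_Integration.integral_add[OF i1 i1, symmetric])
         (simp add: hdot_add_left add_divide_distrib ring_distribs)
    have "\<phi> u * (hdot (r *\<^sub>R v) u / t * exp (hdot z u / t)) = r *\<^sub>R (\<phi> u * (hdot v u / t * exp (hdot z u / t)))" for u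
      by (simp add: hdot_scaleR_left scaleR_conv_of_real[where 'a=complex])
    then show "?D (r *\<^sub>R v) = r *\<^sub>R ?D v"
      by (simp only: integral_scaleR_right)
    have "cmod (?D v) \<le> (LINT u|gauss t. norm v * (cmod (\<phi> u) * exp ((norm z + 1) / t * norm u)))"
    proof (rule Bochner_Integration.integral_norm_bound_integral[OF i1 integrable_mult_right[OF iz]])
      fix u
      show "cmod (\<phi> u * (hdot v u / t * exp (hdot z u / t))) \<le> norm v * (cmod (\<phi> u) * exp ((norm z + 1) / t * norm u))"
        using mult_left_mono[OF dbound[of v u], of "cmod (\<phi> u)"] by (simp only: norm_mult mult.left_commute norm_ge_zero)
    qed
    then show "cmod (?D v) \<le> norm v * (LINT u|gauss t. cmod (\<phi> u) * exp ((norm z + 1) / t * norm u))"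
      by (simp only: integral_mult_right_zero)
  qed
  \<comment> \<open>Of the three additional exponentials, one bounds
    \<open>exp \<bar>Re ?w\<bar>\<close> in Taylor's remainder, using \<open>norm v \<le> 1\<close>,
    and two bound the square of \<open>x u\<close> by way of \<open>xexp\<close>.\<close>
  define C where "C = (LINT u|gauss t. cmod (\<phi> u) * exp ((norm z + 3) / t * norm u))"
  have iC: "integrable (gauss t) (\<lambda>u. cmod (\<phi> u) * exp ((norm z + 3) / t * norm u))"
    using t by (intro int) simp
  show "norm (P_op t \<phi> y - P_op t \<phi> z - ?D (y - z)) / norm (y - z) \<le> C * norm (y - z)"
    if y: "y \<in> UNIV" "y \<noteq> z" "dist y z < 1" for y
  proof -
    define v where "v = y - z"
    have v: "norm v \<le> 1" "norm v > 0" using y by (simp_all add: v_def dist_norm)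
    define R where "R u = \<phi> u * exp (hdot y u / t) - \<phi> u * exp (hdot z u / t) - \<phi> u * (hdot v u / t * exp (hdot z u / t))" for u
    have iR: "integrable (gauss t) R"
      unfolding R_def by (intro Bochner_Integration.integrable_diff i0 i1)
    have "P_op t \<phi> y - P_op t \<phi> z - ?D v = integral\<^sup>L (gauss t) R"
      unfolding R_def P_op_def P_integrand_def
      by (simp only: Bochner_Integration.integral_diff i0 i1 Bochner_Integration.integrable_diff)
    also have "cmod \<dots> \<le> (LINT u|gauss t. (norm v)\<^sup>2 * (cmod (\<phi> u) * exp ((norm z + 3) / t * norm u)))"
    proof (rule Bochner_Integration.integral_norm_bound_integral[OF iR integrable_mult_right[OF iC]])
      fix u
      let ?w = "hdot v u / t"
      have "hdot y u / t = hdot z u / t + ?w" by (simp add: v_def hdot_diff_left diff_divide_distrib)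
      then have "R u = \<phi> u * (exp (hdot z u / t) * (exp ?w - (\<Sum>k\<le>1. ?w ^ k / fact k)))"
        unfolding R_def by (simp add: exp_add algebra_simps)
      moreover have "cmod (exp ?w - (\<Sum>k\<le>1. ?w ^ k / fact k)) \<le> exp (x u) * (norm v * exp (x u))\<^sup>2"
      proof -
        have "\<bar>Re ?w\<bar> \<le> x u"
          using order_trans[OF abs_Re_le_cmod hx[of v u]] mult_right_mono[OF v(1) x0[of u]] by simp
        moreover have "cmod ?w \<le> norm v * exp (x u)"
          by (rule order_trans[OF hx mult_left_mono[OF xexp]]) simp
        ultimately have "exp \<bar>Re ?w\<bar> * (cmod ?w)\<^sup>2 \<le> exp (x u) * (norm v * exp (x u))\<^sup>2"
          by (intro mult_mono power_mono) auto
        then show ?thesis using Taylor_exp[of ?w 1] by (simp add: numeral_2_eq_2)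
      qed
      ultimately have "cmod (R u) \<le> cmod (\<phi> u) * (exp (norm z * x u) * (exp (x u) * (norm v * exp (x u))\<^sup>2))"
        using ex[of z u] by (auto simp: norm_mult intro!: mult_left_mono mult_mono)
      also have "\<dots> = (norm v)\<^sup>2 * (cmod (\<phi> u) * exp ((norm z + 3) * x u))"
        by (simp add: power_mult_distrib exp_double[symmetric] exp_add[symmetric] algebra_simps)
      finally show "cmod (R u) \<le> (norm v)\<^sup>2 * (cmod (\<phi> u) * exp ((norm z + 3) / t * norm u))"
        by (simp only: xN)
    qed
    also have "\<dots> = (norm v)\<^sup>2 * C" unfolding C_def by (rule integral_mult_right_zero)
    finally have "cmod (P_op t \<phi> y - P_op t \<phi> z - ?D v) \<le> C * norm v * norm v"
      by (simp add: power2_eq_square mult_ac)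
    then show ?thesis using v(2) unfolding v_def[symmetric] by (simp add: pos_divide_le_eq)
  qed
  have "((\<lambda>y. C * norm (y - z)) \<longlongrightarrow> C * norm (z - z)) (at z)"
    by (intro tendsto_intros)
  then show "((\<lambda>y. C * norm (y - z)) \<longlongrightarrow> 0) (at z)" by simp
qed simp

lemma entire_P_op:
  fixes \<phi> :: "complex ^ 'n::finite \<Rightarrow> complex"
  assumes "t > 0" and "\<phi> \<in> borel_measurable (gauss t)"
    and "\<And>N. N \<ge> 0 \<Longrightarrow> integrable (gauss t) (\<lambda>u. cmod (\<phi> u) * exp (N * norm u))"
  shows "entire (P_op t \<phi>)"
  unfolding entire_def
proof (intro allI exI conjI)
  fix z
  show "(P_op t \<phi> has_derivative (\<lambda>v. LINT u|gauss t. \<phi> u * (hdot v u / t * exp (hdot z u / t)))) (at z)"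
    by (rule P_op_has_derivative[OF assms])
  fix c v
  have "\<phi> u * (hdot (c *s v) u / t * exp (hdot z u / t)) = c * (\<phi> u * (hdot v u / t * exp (hdot z u / t)))" for u
    by (simp add: hdot_smult_left)
  then show "(LINT u|gauss t. \<phi> u * (hdot (c *s v) u / t * exp (hdot z u / t))) =
      c * (LINT u|gauss t. \<phi> u * (hdot v u / t * exp (hdot z u / t)))"
    by (simp only: integral_mult_right_zero)
qed

text \<open>The exponential in the definition of \<open>I_op\<close> exactly undoes the
  normalisation of the two kernels. What is left is the integral kernel of projecting, multiplying
  by f and projecting again.\<close>

lemma I_integrand_eq:
  "I_integrand t f g z w = (LINT u|gauss t. f u * exp ((hdot u w + hdot z u) / t)) * g w"
proof -
  have "(norm (z - w))\<^sup>2 = (norm z)\<^sup>2 + (norm w)\<^sup>2 - 2 * (z \<bullet> w)"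
    unfolding power2_norm_eq_inner by (simp add: inner_simps inner_commute)
  then have "1 / (2 * t) * (norm (z - w))\<^sup>2 + 1 / t * Re (hdot z w) + - ((norm w)\<^sup>2 + (norm z)\<^sup>2) / (2 * t) = 0"
    by (simp add: Re_hdot add_divide_distrib diff_divide_distrib)
  then have "exp (1 / (2 * t) * (norm (z - w))\<^sup>2 + 1 / t * Re (hdot z w)) * exp (- ((norm w)\<^sup>2 + (norm z)\<^sup>2) / (2 * t)) = 1"
    by (simp only: exp_add[symmetric] exp_zero)
  then have "complex_of_real (exp (1 / (2 * t) * (norm (z - w))\<^sup>2 + 1 / t * Re (hdot z w))) *
      of_real (exp (- ((norm w)\<^sup>2 + (norm z)\<^sup>2) / (2 * t))) = 1"
    by (metis of_real_mult of_real_1)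
  then show ?thesis
    unfolding I_integrand_def berezin_eq mult.assoc[symmetric] by (simp only: mult_1_left)
qed

text \<open>Assumptions \<open>ig\<close> and \<open>bg\<close> hold for every exponent, so Fubini
  is done once for all p. The growth allowed by \<open>bg\<close> consumes half of the Gaussian
  density, and the other half is what the weighted integrability of f requires.\<close>

lemma I_op_eq_toeplitz_P_op:
  fixes f g :: "complex ^ 'n::finite \<Rightarrow> complex"
  assumes t: "t > 0" and f: "f \<in> borel_measurable lebesgue"
    and w: "\<And>N. N \<ge> 0 \<Longrightarrow> integrable lebesgue (\<lambda>u. cmod (f u) * exp (N * norm u - (norm u)\<^sup>2 / (2 * t)))"
    and g: "g \<in> borel_measurable lebesgue"
    and ig: "\<And>u. integrable (gauss t) (P_integrand t g u)"
    and bg: "\<And>u. (LINT w|gauss t. cmod (P_integrand t g u w)) \<le> M * exp ((norm u)\<^sup>2 / (2 * t))"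
  shows "integrable (gauss t) (I_integrand t f g z)"
    and "I_op t f g z = toeplitz t f (P_op t g) z"
    and "integrable (gauss t) (P_integrand t (\<lambda>u. f u * P_op t g u) z)"
    and "entire (I_op t f g)"
proof -
  interpret G: sigma_finite_measure "gauss t :: (complex ^ 'n) measure" by (rule sigma_finite_gauss[OF t])
  interpret GG: pair_sigma_finite "gauss t :: (complex ^ 'n) measure" "gauss t :: (complex ^ 'n) measure" ..
  have [measurable]: "f \<in> borel_measurable (gauss t)" "g \<in> borel_measurable (gauss t)"
    using f g by (simp_all add: borel_measurable_gauss)
  \<comment> \<open>Assumption \<open>w\<close> read with respect to \<open>gauss t\<close>, whose
    density turns the exponent \<open>+ (norm u)\<^sup>2 / (2 * t)\<close> into its
    negative.\<close>
  have wf: "integrable (gauss t) (\<lambda>u. cmod (f u) * exp (N * norm u + (norm u)\<^sup>2 / (2 * t)))" if "N \<ge> 0" for N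
  proof -
    have "(\<lambda>u. exp (- (norm u)\<^sup>2 / t) *\<^sub>R (cmod (f u) * exp (N * norm u + (norm u)\<^sup>2 / (2 * t)))) =
        (\<lambda>u. cmod (f u) * exp (N * norm u - (norm u)\<^sup>2 / (2 * t)))"
    proof
      fix u :: "complex ^ 'n"
      have "- (norm u)\<^sup>2 / t + (N * norm u + (norm u)\<^sup>2 / (2 * t)) = N * norm u - (norm u)\<^sup>2 / (2 * t)"
        using t by (simp add: field_simps)
      then show "exp (- (norm u)\<^sup>2 / t) *\<^sub>R (cmod (f u) * exp (N * norm u + (norm u)\<^sup>2 / (2 * t))) =
          cmod (f u) * exp (N * norm u - (norm u)\<^sup>2 / (2 * t))"
        by (simp only: real_scaleR_def mult.left_commute[of _ "cmod (f u)"] exp_add[symmetric])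
    qed
    moreover have "(\<lambda>u. cmod (f u) * exp (N * norm u + (norm u)\<^sup>2 / (2 * t))) \<in> borel_measurable (gauss t)"
      by measurable
    then have "(\<lambda>u. cmod (f u) * exp (N * norm u + (norm u)\<^sup>2 / (2 * t))) \<in> borel_measurable lebesgue"
      by (simp only: borel_measurable_gauss)
    ultimately show ?thesis using w[OF that] by (simp only: integrable_gauss_iff[OF t])
  qed
  have Pm [measurable]: "P_op t g \<in> borel_measurable (gauss t)"
    unfolding P_op_def P_integrand_def by measurable
  have Pb: "cmod (P_op t g u) \<le> M * exp ((norm u)\<^sup>2 / (2 * t))" for u
    unfolding P_op_def by (rule order_trans[OF integral_norm_bound bg])
  have M0: "M \<ge> 0" using order_trans[OF norm_ge_zero Pb[of 0]] by simp
  define \<Psi> where "\<Psi> z u v = f u * exp (hdot z u / t) * P_integrand t g u v" for z u v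
  have \<Psi>m: "(\<lambda>(u, v). \<Psi> z u v) \<in> borel_measurable (gauss t \<Otimes>\<^sub>M gauss t)" for z
    unfolding \<Psi>_def P_integrand_def split_def by measurable
  have ez: "cmod (exp (hdot z u / t)) \<le> exp (norm z / t * norm u)" for z u
  proof -
    have "Re (hdot z u / t) \<le> norm z / t * norm u"
      using order_trans[OF complex_Re_le_cmod norm_hdot_le[of z u]] t by (simp add: divide_right_mono)
    then show ?thesis by (simp add: norm_exp_eq_Re)
  qed
  have int: "integrable (gauss t \<Otimes>\<^sub>M gauss t) (\<lambda>(u, v). \<Psi> z u v)" for z
  proof (rule GG.Fubini_integrable[OF \<Psi>m])
    show "AE u in gauss t. integrable (gauss t) (\<lambda>v. case (u, v) of (u, v) \<Rightarrow> \<Psi> z u v)"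
      unfolding \<Psi>_def using ig by simp
    have eq: "(LINT v|gauss t. norm (case (u, v) of (u, v) \<Rightarrow> \<Psi> z u v)) =
        cmod (f u) * cmod (exp (hdot z u / t)) * (LINT v|gauss t. cmod (P_integrand t g u v))" for u
      unfolding \<Psi>_def by (simp only: split norm_mult integral_mult_right_zero)
    show "integrable (gauss t) (\<lambda>u. LINT v|gauss t. norm (case (u, v) of (u, v) \<Rightarrow> \<Psi> z u v))"
    proof (rule Bochner_Integration.integrable_bound)
      show "integrable (gauss t) (\<lambda>u. M * (cmod (f u) * exp (norm z / t * norm u + (norm u)\<^sup>2 / (2 * t))))"
        using t by (intro integrable_mult_right wf) simp
      show "(\<lambda>u. LINT v|gauss t. norm (case (u, v) of (u, v) \<Rightarrow> \<Psi> z u v)) \<in> borel_measurable (gauss t)"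
        unfolding \<Psi>_def P_integrand_def by measurable
      have "cmod (f u) * cmod (exp (hdot z u / t)) * (LINT v|gauss t. cmod (P_integrand t g u v)) \<le>
         M * (cmod (f u) * exp (norm z / t * norm u + (norm u)\<^sup>2 / (2 * t)))" for u
      proof -
        have "cmod (f u) * cmod (exp (hdot z u / t)) * (LINT v|gauss t. cmod (P_integrand t g u v)) \<le>
            cmod (f u) * exp (norm z / t * norm u) * (M * exp ((norm u)\<^sup>2 / (2 * t)))"
          by (intro mult_mono mult_left_mono ez bg integral_nonneg_AE mult_nonneg_nonneg) auto
        then show ?thesis by (simp add: exp_add mult_ac)
      qed
      then show "AE u in gauss t. norm (LINT v|gauss t. norm (case (u, v) of (u, v) \<Rightarrow> \<Psi> z u v)) \<le>
          norm (M * (cmod (f u) * exp (norm z / t * norm u + (norm u)\<^sup>2 / (2 * t))))"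
        unfolding eq by (intro always_eventually allI) (simp add: M0 abs_mult integral_nonneg_AE)
    qed
  qed
  have I\<Psi>: "I_integrand t f g z v = (LINT u|gauss t. \<Psi> z u v)" for z v
  proof -
    have "\<Psi> z u v = f u * exp ((hdot u v + hdot z u) / t) * g v" for u
      by (simp add: \<Psi>_def P_integrand_def exp_add[symmetric] add_divide_distrib)
         (simp add: exp_add)
    then show ?thesis unfolding I_integrand_eq by (simp only: integral_mult_left_zero)
  qed
  show "integrable (gauss t) (I_integrand t f g z)"
    using GG.integrable_snd[OF int[of z]] by (simp only: I\<Psi>[abs_def])
  have inner: "(LINT v|gauss t. \<Psi> z u v) = P_integrand t (\<lambda>u. f u * P_op t g u) z u" for z u
    unfolding \<Psi>_def integral_mult_right_zero P_op_def[symmetric] P_integrand_def[of _ "\<lambda>u. f u * P_op t g u"]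
    by (simp only: mult_ac)
  have eq: "I_op t f g z = P_op t (\<lambda>u. f u * P_op t g u) z" for z
    unfolding I_op_def I\<Psi> P_op_def[of _ "\<lambda>u. f u * P_op t g u"]
    unfolding inner[symmetric]
    by (rule GG.Fubini_integral[OF int])
  then show "I_op t f g z = toeplitz t f (P_op t g) z" by (simp add: toeplitz_def)
  show "integrable (gauss t) (P_integrand t (\<lambda>u. f u * P_op t g u) z)"
    using GG.integrable_fst[OF int[of z]] by (simp only: inner)
  have "entire (P_op t (\<lambda>u. f u * P_op t g u))"
  proof (rule entire_P_op[OF t])
    show "(\<lambda>u. f u * P_op t g u) \<in> borel_measurable (gauss t)" by measurable
    fix N :: real assume N: "N \<ge> 0"
    show "integrable (gauss t) (\<lambda>u. cmod (f u * P_op t g u) * exp (N * norm u))"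
    proof (rule Bochner_Integration.integrable_bound[OF integrable_mult_right[OF wf[OF N], of M]])
      show "(\<lambda>u. cmod (f u * P_op t g u) * exp (N * norm u)) \<in> borel_measurable (gauss t)" by measurable
      have "cmod (f u * P_op t g u) * exp (N * norm u) \<le> M * (cmod (f u) * exp (N * norm u + (norm u)\<^sup>2 / (2 * t)))" for u
      proof -
        have "cmod (f u * P_op t g u) * exp (N * norm u) \<le> cmod (f u) * (M * exp ((norm u)\<^sup>2 / (2 * t))) * exp (N * norm u)"
          unfolding norm_mult by (intro mult_right_mono mult_left_mono Pb) auto
        then show ?thesis by (simp add: exp_add mult_ac)
      qed
      then show "AE u in gauss t. norm (cmod (f u * P_op t g u) * exp (N * norm u)) \<le>
          norm (M * (cmod (f u) * exp (N * norm u + (norm u)\<^sup>2 / (2 * t))))"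
        by (intro always_eventually allI) (simp add: M0 abs_mult)
    qed
  qed
  moreover have "I_op t f g = P_op t (\<lambda>u. f u * P_op t g u)" using eq by blast
  ultimately show "entire (I_op t f g)" by simp
qed

section \<open>Weighted norm estimates\<close>

lemma powr_ge_tangent:
  fixes x m q :: real
  assumes "x \<ge> 0" "m > 0" "q \<ge> 1"
  shows "m powr q + q * m powr (q - 1) * (x - m) \<le> x powr q"
proof (cases "x = 0")
  case True
  \<comment> \<open>Convexity is used on the open half line, so the endpoint is checked by hand: the
    tangent takes the value \<open>(1 - q) * m powr q\<close> there, which is at most
    \<open>0 powr q = 0\<close>.\<close>
  have "m powr (q - 1) * m = m powr q"
    using assms powr_add[of m "q - 1" 1] by simp
  then have "m powr q + q * m powr (q - 1) * (x - m) = (1 - q) * m powr q"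
    using True by (simp add: algebra_simps)
  then show ?thesis using assms True by (simp add: mult_nonpos_nonneg)
next
  case False
  have "((\<lambda>x. x powr q) has_field_derivative q * m powr (q - 1)) (at m within {0<..})"
    using assms by (auto intro!: derivative_eq_intros)
  then have "x powr q - m powr q \<ge> q * m powr (q - 1) * (x - m)"
    using assms False by (intro convex_on_imp_above_tangent[OF powr_convex[OF assms(3)]]) (auto simp: interior_open)
  then show ?thesis by simp
qed

text \<open>Jensen's inequality for the measure with density \<open>k\<close>, of mass
  \<open>c\<close> instead of 1; hence the power of \<open>c\<close>. The tangent of the power
  function is taken at the mean \<open>I / c\<close>, so its linear part integrates to zero. A
  vanishing mean is treated apart because the tangent is taken at a positive point.\<close>

lemma weighted_jensen_powr:
  fixes k \<phi> :: "'a \<Rightarrow> real"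
  assumes q: "q \<ge> 1" and k: "integrable M k" "\<And>x. k x \<ge> 0" and c: "c > 0" "integral\<^sup>L M k = c"
    and \<phi>: "\<And>x. \<phi> x \<ge> 0" and i1: "integrable M (\<lambda>x. k x * \<phi> x)" and iq: "integrable M (\<lambda>x. k x * \<phi> x powr q)"
  shows "(LINT x|M. k x * \<phi> x) powr q \<le> c powr (q - 1) * (LINT x|M. k x * \<phi> x powr q)"
proof -
  define I where "I = (LINT x|M. k x * \<phi> x)"
  have I0: "I \<ge> 0" unfolding I_def using k(2) \<phi> by (intro integral_nonneg_AE) auto
  have R0: "0 \<le> c powr (q - 1) * (LINT x|M. k x * \<phi> x powr q)"
    using k(2) \<phi> by (intro mult_nonneg_nonneg integral_nonneg_AE) auto
  show ?thesis
  proof (cases "I = 0")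
    case True
    then show ?thesis using R0 unfolding I_def by simp
  next
    case False
    define m where "m = I / c"
    have m: "m > 0" using False I0 c by (simp add: m_def)
    define d where "d = q * m powr (q - 1)"
    have "(LINT x|M. k x * (m powr q - d * m) + d * (k x * \<phi> x)) \<le> (LINT x|M. k x * \<phi> x powr q)"
    proof (rule integral_mono)
      show "integrable M (\<lambda>x. k x * (m powr q - d * m) + d * (k x * \<phi> x))"
        using k i1 by simp
      show "k x * (m powr q - d * m) + d * (k x * \<phi> x) \<le> k x * \<phi> x powr q" for x
        using mult_left_mono[OF powr_ge_tangent[OF \<phi>[of x] m q] k(2)[of x]]
        by (simp add: d_def algebra_simps)
    qed (rule iq)
    also have "(LINT x|M. k x * (m powr q - d * m) + d * (k x * \<phi> x)) = c * (m powr q - d * m) + d * I"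
      using k i1 c by (simp add: I_def)
    also have "\<dots> = c * m powr q" using c by (simp add: m_def algebra_simps)
    finally have "c * m powr q \<le> (LINT x|M. k x * \<phi> x powr q)" .
    then have "c powr (q - 1) * (c * m powr q) \<le> c powr (q - 1) * (LINT x|M. k x * \<phi> x powr q)"
      by (intro mult_left_mono) auto
    also have "c powr (q - 1) * (c * m powr q) = I powr q"
    proof -
      have "c powr (q - 1) * c = c powr q" using c powr_add[of c "q - 1" 1] by simp
      moreover have "c powr q * m powr q = I powr q"
        using c m I0 by (simp add: m_def powr_mult[symmetric])
      ultimately show ?thesis by (simp only: mult.assoc[symmetric])
    qed
    finally show ?thesis by (simp add: I_def)
  qed
qed

lemma has_bochner_integral_gaussian_lebesgue:
  fixes m :: "complex ^ 'n::finite"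
  assumes "c > 0"
  shows "has_bochner_integral lebesgue (\<lambda>z. exp (- c * (norm (z - m))\<^sup>2)) ((pi / c) ^ CARD('n))"
    and "has_bochner_integral lebesgue (\<lambda>z. exp (- c * (norm (m - z))\<^sup>2)) ((pi / c) ^ CARD('n))"
  using has_bochner_integral_gaussian[OF assms, of m]
  by (simp_all add: has_bochner_integral_iff integrable_completion integral_completion norm_minus_commute)

text \<open>The kernel is integrable and at most 1, which suits the bounded part \<open>A\<close>
  and the integrable part \<open>\<psi>\<close> respectively. Both estimates are uniform in
  \<open>z\<close>.\<close>

lemma gaussian_convolution_bound:
  fixes \<phi> \<psi> :: "complex ^ 'n::finite \<Rightarrow> real"
  assumes c: "c > 0" and \<phi> [measurable]: "\<phi> \<in> borel_measurable lebesgue" "\<And>w. \<phi> w \<ge> 0"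
    and \<psi>: "integrable lebesgue \<psi>" "\<And>w. \<psi> w \<ge> 0" and A: "A \<ge> 0"
    and le: "AE w in lebesgue. \<phi> w \<le> A + \<psi> w"
  shows "integrable lebesgue (\<lambda>w. exp (- c * (norm (z - w))\<^sup>2) * \<phi> w)" (is ?int)
    and "(LINT w|lebesgue. exp (- c * (norm (z - w))\<^sup>2) * \<phi> w) \<le> A * (pi / c) ^ CARD('n) + integral\<^sup>L lebesgue \<psi>"
proof -
  define k where "k w = exp (- c * (norm (z - w))\<^sup>2)" for w
  have k1: "0 \<le> k w" "k w \<le> 1" for w using c by (simp_all add: k_def)
  have km: "k \<in> borel_measurable lebesgue"
    unfolding k_def by (intro measurable_lebesgue_borel) measurable
  note hk = has_bochner_integral_gaussian_lebesgue(2)[OF c, of z, folded k_def]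
  have ib: "integrable lebesgue (\<lambda>w. A * k w + \<psi> w)"
    using hk \<psi> by (simp add: has_bochner_integral_iff)
  have bd: "AE w in lebesgue. k w * \<phi> w \<le> A * k w + \<psi> w"
    using le
  proof eventually_elim
    case (elim w)
    have "k w * \<phi> w \<le> k w * A + k w * \<psi> w"
      using mult_left_mono[OF elim k1(1)[of w]] by (simp add: distrib_left)
    also have "k w * \<psi> w \<le> \<psi> w" using k1[of w] \<psi>(2)[of w] by (simp add: mult_left_le_one_le)
    finally show ?case by (simp add: mult.commute)
  qed
  have int: "integrable lebesgue (\<lambda>w. k w * \<phi> w)"
  proof (rule Bochner_Integration.integrable_bound[OF ib])
    show "(\<lambda>w. k w * \<phi> w) \<in> borel_measurable lebesgue" using km by measurable
    show "AE w in lebesgue. norm (k w * \<phi> w) \<le> norm (A * k w + \<psi> w)"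
      using bd by eventually_elim (simp add: k1 \<phi>(2) order_trans[OF _ abs_ge_self])
  qed
  then show ?int by (simp only: k_def)
  have "(LINT w|lebesgue. k w * \<phi> w) \<le> (LINT w|lebesgue. A * k w + \<psi> w)"
    by (rule integral_mono_AE[OF int ib bd])
  also have "\<dots> = A * (pi / c) ^ CARD('n) + integral\<^sup>L lebesgue \<psi>"
    using hk \<psi>(1) by (simp add: has_bochner_integral_iff)
  finally show "(LINT w|lebesgue. exp (- c * (norm (z - w))\<^sup>2) * \<phi> w) \<le> A * (pi / c) ^ CARD('n) + integral\<^sup>L lebesgue \<psi>"
    by (simp only: k_def)
qed

lemma has_bochner_integral_gaussian_conv:
  fixes \<psi> :: "complex ^ 'n::finite \<Rightarrow> real"
  assumes c: "c > 0" and \<psi>: "integrable lebesgue \<psi>" "\<And>w. \<psi> w \<ge> 0"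
  shows "has_bochner_integral lebesgue (\<lambda>z. LINT w|lebesgue. exp (- c * (norm (z - w))\<^sup>2) * \<psi> w)
    ((pi / c) ^ CARD('n) * integral\<^sup>L lebesgue \<psi>)"
proof -
  define F where "F w z = exp (- c * (norm (z - w))\<^sup>2) * \<psi> w" for w z
  have [measurable]: "\<psi> \<in> borel_measurable lebesgue" using \<psi>(1) by simp
  have meas: "(\<lambda>(w, z). F w z) \<in> borel_measurable (lebesgue \<Otimes>\<^sub>M lebesgue)"
    unfolding F_def split_def by measurable
  note hk = has_bochner_integral_gaussian_lebesgue(1)[OF c, where 'n='n]
  have inner: "(LINT z|lebesgue. F w z) = (pi / c) ^ CARD('n) * \<psi> w" for w
    unfolding F_def integral_mult_left_zero has_bochner_integral_integral_eq[OF hk] ..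
  have int: "integrable (lebesgue \<Otimes>\<^sub>M lebesgue) (\<lambda>(w, z). F w z)"
  proof (rule lebesgue_pair.Fubini_integrable[OF meas])
    have "norm (F w z) = F w z" for w z using \<psi>(2) by (simp add: F_def)
    then show "integrable lebesgue (\<lambda>w. LINT z|lebesgue. norm (case (w, z) of (w, z) \<Rightarrow> F w z))"
      using \<psi>(1) by (simp add: inner)
    show "AE w in lebesgue. integrable lebesgue (\<lambda>z. case (w, z) of (w, z) \<Rightarrow> F w z)"
      using hk by (simp add: F_def has_bochner_integral_iff)
  qed
  have "(LINT z|lebesgue. LINT w|lebesgue. F w z) = (LINT w|lebesgue. LINT z|lebesgue. F w z)"
    by (rule lebesgue_pair.Fubini_integral[OF int])
  then have "(LINT z|lebesgue. LINT w|lebesgue. F w z) = (pi / c) ^ CARD('n) * integral\<^sup>L lebesgue \<psi>"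
    by (simp add: inner)
  then show ?thesis
    using lebesgue_pair.integrable_snd[OF int] by (simp add: has_bochner_integral_iff F_def)
qed

text \<open>The parameter of the Gaussian measure for exponent q, namely \<open>2 * t / q\<close>,
  is such that \<open>weighted t g powr q\<close> absorbs its density exactly. Up to a constant, all
  the norms thus become ordinary Lebesgue norms of this one function, for the infinite exponent
  too.\<close>

definition weighted :: "real \<Rightarrow> (complex ^ 'n::finite \<Rightarrow> complex) \<Rightarrow> complex ^ 'n \<Rightarrow> real" where
  "weighted t g w = cmod (g w) * exp (- (norm w)\<^sup>2 / (2 * t))"

lemma weighted_nonneg [simp]: "weighted t g w \<ge> 0"
  by (simp add: weighted_def)

lemma borel_measurable_weighted:
  fixes g :: "complex ^ 'n::finite \<Rightarrow> complex"
  assumes "g \<in> borel_measurable lebesgue"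
  shows "weighted t g \<in> borel_measurable lebesgue"
proof -
  have "(\<lambda>w::complex ^ 'n. exp (- (norm w)\<^sup>2 / (2 * t))) \<in> borel_measurable lebesgue"
    by (rule measurable_lebesgue_borel) measurable
  then show ?thesis
    unfolding weighted_def[abs_def] by (intro borel_measurable_times measurable_compose[OF assms borel_measurable_norm])
qed

lemma weighted_powr:
  assumes "t > 0" "q > 0"
  shows "exp (- (norm w)\<^sup>2 / (2 * t / q)) * cmod (g w) powr q = weighted t g w powr q"
  using assms by (simp add: weighted_def powr_mult exp_powr_real mult_ac)

lemma Lp_space_gauss_iff:
  fixes g :: "complex ^ 'n::finite \<Rightarrow> complex"
  assumes t: "t > 0" and q: "q > 0"
  shows "g \<in> Lp_space (gauss (2 * t / q)) q \<longleftrightarrow>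
    g \<in> borel_measurable lebesgue \<and> integrable lebesgue (\<lambda>w. weighted t g w powr q)"
proof -
  have "integrable (gauss (2 * t / q)) (\<lambda>x. cmod (g x) powr q) \<longleftrightarrow> integrable lebesgue (\<lambda>w. weighted t g w powr q)"
    if g: "g \<in> borel_measurable lebesgue"
  proof -
    have "(\<lambda>x. cmod (g x) powr q) \<in> borel_measurable lebesgue" using g by measurable
    then show ?thesis
      using t q by (simp only: integrable_gauss_iff divide_pos_pos mult_pos_pos zero_less_numeral real_scaleR_def weighted_powr)
  qed
  then show ?thesis unfolding Lp_space_def by (auto simp: borel_measurable_gauss)
qed

lemma Lp_norm_gauss:
  fixes g :: "complex ^ 'n::finite \<Rightarrow> complex"
  assumes t: "t > 0" and q: "q > 0" and g: "g \<in> borel_measurable lebesgue"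
  shows "Lp_norm (gauss (2 * t / q)) q g =
    (1 / (pi * (2 * t / q)) ^ CARD('n) * (LINT w|lebesgue. weighted t g w powr q)) powr (1 / q)"
proof -
  have "(\<lambda>x. cmod (g x) powr q) \<in> borel_measurable lebesgue" using g by measurable
  then show ?thesis
    unfolding Lp_norm_def using t q
    by (simp only: integral_gauss divide_pos_pos mult_pos_pos zero_less_numeral real_scaleR_def weighted_powr)
qed

text \<open>Young's inequality for an integrable kernel: Jensen bounds the q-th power of the
  convolution by the convolution of the q-th power, and integrating over z yields the mass of the
  kernel once more.\<close>

lemma weighted_convolution_Lp:
  fixes F g :: "complex ^ 'n::finite \<Rightarrow> complex"
  assumes t: "t > 0" and q: "q \<ge> 1" and c: "c > 0" and \<kappa>: "\<kappa> \<ge> 0"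
    and F: "F \<in> borel_measurable lebesgue" and g: "g \<in> Lp_space (gauss (2 * t / q)) q"
    and le: "\<And>z. weighted t F z \<le> \<kappa> * (LINT w|lebesgue. exp (- c * (norm (z - w))\<^sup>2) * weighted t g w)"
  shows "F \<in> Lp_space (gauss (2 * t / q)) q"
    and "Lp_norm (gauss (2 * t / q)) q F \<le> \<kappa> * (pi / c) ^ CARD('n) * Lp_norm (gauss (2 * t / q)) q g"
proof -
  have q0: "q > 0" using q by simp
  have gm: "g \<in> borel_measurable lebesgue" and gi: "integrable lebesgue (\<lambda>w. weighted t g w powr q)"
    using g by (simp_all add: Lp_space_gauss_iff[OF t q0])
  define \<phi> where "\<phi> = weighted t g"
  have \<phi>m: "\<phi> \<in> borel_measurable lebesgue" unfolding \<phi>_def by (rule borel_measurable_weighted[OF gm])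
  have \<phi>0: "\<phi> w \<ge> 0" for w by (simp add: \<phi>_def)
  define c1 where "c1 = (pi / c) ^ CARD('n)"
  have c1: "c1 > 0" using c by (simp add: c1_def)
  define k where "k z w = exp (- c * (norm (z - w))\<^sup>2)" for z w :: "complex ^ 'n"
  have k0: "k z w \<ge> 0" for z w by (simp add: k_def)
  have hk: "has_bochner_integral lebesgue (k z) c1" for z
    unfolding k_def c1_def by (rule has_bochner_integral_gaussian_lebesgue(2)[OF c])
  have "\<phi> w \<le> 1 + \<phi> w powr q" for w
  proof (cases "\<phi> w \<le> 1")
    case False
    then have "\<phi> w powr 1 \<le> \<phi> w powr q" using q by (intro powr_mono) auto
    then show ?thesis using \<phi>0[of w] by simp
  qed (simp add: add_increasing2)
  then have i1: "integrable lebesgue (\<lambda>w. k z w * \<phi> w)" for z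
    unfolding k_def using gi
    by (intro gaussian_convolution_bound(1)[OF c \<phi>m \<phi>0, of "\<lambda>w. \<phi> w powr q" 1]) (auto simp: \<phi>_def)
  have iq: "integrable lebesgue (\<lambda>w. k z w * \<phi> w powr q)" for z
    unfolding k_def using gi borel_measurable_integrable[OF gi]
    by (intro gaussian_convolution_bound(1)[OF c _ _ , of "\<lambda>w. \<phi> w powr q" "\<lambda>w. \<phi> w powr q" 0]) (auto simp: \<phi>_def)
  define B where "B z = \<kappa> powr q * (c1 powr (q - 1) * (LINT w|lebesgue. k z w * \<phi> w powr q))" for z
  have FB: "weighted t F z powr q \<le> B z" for z
  proof -
    have "weighted t F z powr q \<le> (\<kappa> * (LINT w|lebesgue. k z w * \<phi> w)) powr q"
      using le[of z] q0 by (intro powr_mono2) (auto simp: k_def \<phi>_def)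
    also have "\<dots> = \<kappa> powr q * (LINT w|lebesgue. k z w * \<phi> w) powr q"
      by (rule powr_mult)
    also have "\<dots> \<le> B z"
      unfolding B_def using hk k0 \<phi>0 c1 i1 iq
      by (intro mult_left_mono weighted_jensen_powr[OF q]) (auto simp: has_bochner_integral_iff)
    finally show ?thesis .
  qed
  have "has_bochner_integral lebesgue B (\<kappa> powr q * (c1 powr (q - 1) * (c1 * (LINT w|lebesgue. \<phi> w powr q))))"
    unfolding B_def k_def c1_def using gi
    by (intro has_bochner_integral_mult_right has_bochner_integral_gaussian_conv[OF c]) (auto simp: \<phi>_def)
  also have "\<kappa> powr q * (c1 powr (q - 1) * (c1 * (LINT w|lebesgue. \<phi> w powr q))) = (\<kappa> * c1) powr q * (LINT w|lebesgue. \<phi> w powr q)"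
  proof -
    have "c1 powr (q - 1) * c1 = c1 powr q" using c1 powr_add[of c1 "q - 1" 1] by simp
    then show ?thesis using \<kappa> c1 by (simp add: powr_mult mult.assoc[symmetric])
  qed
  finally have hB: "has_bochner_integral lebesgue B ((\<kappa> * c1) powr q * (LINT w|lebesgue. \<phi> w powr q))" .
  have iF: "integrable lebesgue (\<lambda>z. weighted t F z powr q)"
  proof (rule Bochner_Integration.integrable_bound)
    show "integrable lebesgue B" using hB by (simp add: has_bochner_integral_iff)
    show "(\<lambda>z. weighted t F z powr q) \<in> borel_measurable lebesgue"
      using borel_measurable_weighted[OF F] by measurable
    show "AE z in lebesgue. norm (weighted t F z powr q) \<le> norm (B z)"
      using FB by (auto intro!: always_eventually order_trans[OF _ abs_ge_self])
  qed
  then show "F \<in> Lp_space (gauss (2 * t / q)) q"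
    using F by (simp add: Lp_space_gauss_iff[OF t q0])
  \<comment> \<open>The normalisation of the measure occurs in both norms and cancels, so the
    resulting constant does not depend on q.\<close>
  define C where "C = 1 / (pi * (2 * t / q)) ^ CARD('n)"
  have C: "C \<ge> 0" using t q0 by (simp add: C_def)
  have J0: "(LINT w|lebesgue. \<phi> w powr q) \<ge> 0" by (rule integral_nonneg_AE) simp
  have "(LINT z|lebesgue. weighted t F z powr q) \<le> (\<kappa> * c1) powr q * (LINT w|lebesgue. \<phi> w powr q)"
    using integral_mono[OF iF _ FB] hB by (simp add: has_bochner_integral_iff)
  then have "(C * (LINT z|lebesgue. weighted t F z powr q)) powr (1 / q) \<le>
      (C * ((\<kappa> * c1) powr q * (LINT w|lebesgue. \<phi> w powr q))) powr (1 / q)"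
    using C q0 by (intro powr_mono2 mult_left_mono) (auto intro!: mult_nonneg_nonneg integral_nonneg_AE)
  also have "\<dots> = ((\<kappa> * c1) powr q * (C * (LINT w|lebesgue. \<phi> w powr q))) powr (1 / q)"
    by (simp only: mult.left_commute)
  also have "\<dots> = ((\<kappa> * c1) powr q) powr (1 / q) * (C * (LINT w|lebesgue. \<phi> w powr q)) powr (1 / q)"
    by (rule powr_mult)
  also have "((\<kappa> * c1) powr q) powr (1 / q) = \<kappa> * c1"
    using \<kappa> c1 q0 by (simp add: powr_powr)
  finally show "Lp_norm (gauss (2 * t / q)) q F \<le> \<kappa> * (pi / c) ^ CARD('n) * Lp_norm (gauss (2 * t / q)) q g"
    unfolding Lp_norm_gauss[OF t q0 F] Lp_norm_gauss[OF t q0 gm] C_def \<phi>_def c1_def .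
qed

text \<open>Puts all exponents on one footing: a weighted function is at most bounded plus
  integrable. For finite q this is \<open>x \<le> 1 + x powr q\<close>, and for the infinite
  exponent the integrable part is 0.\<close>

lemma Lt_space_dominated:
  fixes g :: "complex ^ 'n::finite \<Rightarrow> complex"
  assumes t: "t > 0" and p: "1 \<le> p" and g: "g \<in> Lt_space t p"
  obtains A \<psi> where "g \<in> borel_measurable lebesgue" "A \<ge> 0" "integrable lebesgue \<psi>" "\<And>w. \<psi> w \<ge> 0"
    "AE w in lebesgue. weighted t g w \<le> A + \<psi> w"
proof (cases "p = \<infinity>")
  case True
  then have gm: "g \<in> borel_measurable lebesgue" and fin: "Linf_t_norm t g < \<infinity>"
    using g by (auto simp: Lt_space_def)
  have "weighted t g w \<le> enn2real (Linf_t_norm t g) + 0"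
    if "ennreal (cmod (g w * of_real (exp (- (norm w)\<^sup>2 / (2 * t))))) \<le> Linf_t_norm t g" for w
  proof -
    have "enn2real (ennreal (weighted t g w)) \<le> enn2real (Linf_t_norm t g)"
      using that fin by (intro enn2real_mono) (simp_all add: weighted_def norm_mult)
    then show ?thesis by simp
  qed
  then have "AE w in lebesgue. weighted t g w \<le> enn2real (Linf_t_norm t g) + 0"
    using esssup_AE[of "\<lambda>w. ennreal (cmod (g w * of_real (exp (- (norm w)\<^sup>2 / (2 * t)))))" lebesgue]
    unfolding Linf_t_norm_def[symmetric] by (auto elim: eventually_mono)
  then show ?thesis by (intro that[of "enn2real (Linf_t_norm t g)" "\<lambda>_. 0"] gm) auto
next
  case False
  define q where "q = enn2real p"
  have q: "q \<ge> 1"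
    using enn2real_mono[OF p] False by (simp add: q_def less_top)
  have gL: "g \<in> Lp_space (gauss (2 * t / q)) q"
    using g False by (simp add: Lt_space_def q_def)
  then have gm: "g \<in> borel_measurable lebesgue" and gi: "integrable lebesgue (\<lambda>w. weighted t g w powr q)"
    using q by (simp_all add: Lp_space_gauss_iff[OF t])
  have "weighted t g w \<le> 1 + weighted t g w powr q" for w
  proof (cases "weighted t g w \<le> 1")
    case False
    then have "weighted t g w powr 1 \<le> weighted t g w powr q" using q by (intro powr_mono) auto
    then show ?thesis by simp
  qed (simp add: add_increasing2)
  then show ?thesis by (intro that[of 1 "\<lambda>w. weighted t g w powr q"] gm gi) auto
qed

text \<open>Density and kernel together equal \<open>exp ((norm u)\<^sup>2 / (2 * t))\<close> times
  a Gaussian in \<open>u - w\<close>, up to the weight of g. The constant \<open>M\<close> may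
  depend on g, as it only serves to justify Fubini.\<close>

lemma P_integrand_bound:
  fixes g :: "complex ^ 'n::finite \<Rightarrow> complex"
  assumes t: "t > 0" and g: "g \<in> borel_measurable lebesgue" "A \<ge> 0" "integrable lebesgue \<psi>" "\<And>w. \<psi> w \<ge> 0"
    "AE w in lebesgue. weighted t g w \<le> A + \<psi> w"
  obtains M where "\<And>u. integrable (gauss t) (P_integrand t g u)"
    "\<And>u. (LINT w|gauss t. cmod (P_integrand t g u w)) \<le> M * exp ((norm u)\<^sup>2 / (2 * t))"
proof -
  define c where "c = 1 / (2 * t)"
  have c: "c > 0" using t by (simp add: c_def)
  define M where "M = 1 / (pi * t) ^ CARD('n) * (A * (pi / c) ^ CARD('n) + integral\<^sup>L lebesgue \<psi>)"
  note conv = gaussian_convolution_bound[OF c borel_measurable_weighted[OF g(1), of t] weighted_nonneg g(3,4,2,5)]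
  have Pm: "P_integrand t g u \<in> borel_measurable lebesgue" for u
    unfolding P_integrand_def using t
    by (intro borel_measurable_mult_continuous g(1) continuous_intros) auto
  have eq: "exp (- (norm w)\<^sup>2 / t) * cmod (P_integrand t g u w) =
      exp ((norm u)\<^sup>2 / (2 * t)) * (exp (- c * (norm (u - w))\<^sup>2) * weighted t g w)" for u w
  proof -
    have uw: "u \<bullet> w = ((norm u)\<^sup>2 + (norm w)\<^sup>2 - (norm (u - w))\<^sup>2) / 2"
      unfolding power2_norm_eq_inner by (simp add: inner_simps inner_commute)
    have "- (norm w)\<^sup>2 / t + (u \<bullet> w) / t =
        (norm u)\<^sup>2 / (2 * t) + (- c * (norm (u - w))\<^sup>2 + - (norm w)\<^sup>2 / (2 * t))"
      using t unfolding uw c_def by (simp add: field_simps)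
    then have "exp (- (norm w)\<^sup>2 / t) * exp ((u \<bullet> w) / t) =
        exp ((norm u)\<^sup>2 / (2 * t)) * (exp (- c * (norm (u - w))\<^sup>2) * exp (- (norm w)\<^sup>2 / (2 * t)))"
      by (simp only: exp_add[symmetric])
    moreover have "cmod (P_integrand t g u w) = cmod (g w) * exp ((u \<bullet> w) / t)"
      by (simp add: P_integrand_def norm_mult Re_hdot)
    ultimately show ?thesis by (simp only: weighted_def mult.left_commute[of _ "cmod (g w)"])
  qed
  have iP: "integrable (gauss t) (P_integrand t g u)" for u
  proof -
    have "integrable (gauss t) (\<lambda>w. cmod (P_integrand t g u w))"
      using Pm conv(1)[of u] by (subst integrable_gauss_iff[OF t]) (auto simp only: real_scaleR_def eq intro!: integrable_mult_right measurable_compose[OF _ borel_measurable_norm])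
    then show ?thesis using Pm[of u] by (simp add: integrable_norm_iff borel_measurable_gauss)
  qed
  moreover have "(LINT w|gauss t. cmod (P_integrand t g u w)) \<le> M * exp ((norm u)\<^sup>2 / (2 * t))" for u
  proof -
    have "(LINT w|gauss t. cmod (P_integrand t g u w)) =
        1 / (pi * t) ^ CARD('n) * (exp ((norm u)\<^sup>2 / (2 * t)) * (LINT w|lebesgue. exp (- c * (norm (u - w))\<^sup>2) * weighted t g w))"
      using Pm[of u] by (subst integral_gauss[OF t]) (auto simp only: real_scaleR_def eq integral_mult_right_zero intro!: measurable_compose[OF _ borel_measurable_norm])
    also have "\<dots> \<le> 1 / (pi * t) ^ CARD('n) * (exp ((norm u)\<^sup>2 / (2 * t)) * (A * (pi / c) ^ CARD('n) + integral\<^sup>L lebesgue \<psi>))"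
      using conv(2)[of u] t by (intro mult_left_mono) auto
    also have "\<dots> = M * exp ((norm u)\<^sup>2 / (2 * t))" by (simp only: M_def mult_ac)
    finally show ?thesis .
  qed
  ultimately show ?thesis by (rule that)
qed

text \<open>The density and the exponential in \<open>I_op\<close> combine to the quotient of the
  weights at w and at z. All off-diagonal dependence then sits in the Berezin transform, and its
  decay becomes the convolution kernel.\<close>

lemma weighted_I_op_le:
  fixes f g :: "complex ^ 'n::finite \<Rightarrow> complex"
  assumes t: "t > 0" and ber: "\<And>z w. cmod (berezin t f w z) \<le> S * exp (- c * (norm (z - w))\<^sup>2)"
    and g: "g \<in> borel_measurable lebesgue"
    and iI: "integrable (gauss t) (I_integrand t f g z)"
    and ic: "integrable lebesgue (\<lambda>w. exp (- c * (norm (z - w))\<^sup>2) * weighted t g w)"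
  shows "weighted t (I_op t f g) z \<le>
    S / (pi * t) ^ CARD('n) * (LINT w|lebesgue. exp (- c * (norm (z - w))\<^sup>2) * weighted t g w)"
proof -
  let ?e = "exp ((norm z)\<^sup>2 / (2 * t))"
  have Im: "I_integrand t f g z \<in> borel_measurable lebesgue"
    using borel_measurable_integrable[OF iI] by (simp add: borel_measurable_gauss)
  have iI': "integrable lebesgue (\<lambda>w. exp (- (norm w)\<^sup>2 / t) *\<^sub>R I_integrand t f g z w)"
    using iI unfolding integrable_gauss_iff[OF t Im] .
  have le: "norm (exp (- (norm w)\<^sup>2 / t) *\<^sub>R I_integrand t f g z w) \<le>
      ?e * S * (exp (- c * (norm (z - w))\<^sup>2) * weighted t g w)" for w
  proof -
    have "(norm (z - w))\<^sup>2 = (norm z)\<^sup>2 + (norm w)\<^sup>2 - 2 * (z \<bullet> w)"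
      unfolding power2_norm_eq_inner by (simp add: inner_simps inner_commute)
    then have "- (norm w)\<^sup>2 / t + (1 / (2 * t) * (norm (z - w))\<^sup>2 + 1 / t * Re (hdot z w)) =
        (norm z)\<^sup>2 / (2 * t) + - (norm w)\<^sup>2 / (2 * t)"
      using t by (simp add: Re_hdot field_simps)
    then have e: "exp (- (norm w)\<^sup>2 / t) * exp (1 / (2 * t) * (norm (z - w))\<^sup>2 + 1 / t * Re (hdot z w)) =
        ?e * exp (- (norm w)\<^sup>2 / (2 * t))"
      by (simp only: exp_add[symmetric])
    have "norm (exp (- (norm w)\<^sup>2 / t) *\<^sub>R I_integrand t f g z w) =
        (exp (- (norm w)\<^sup>2 / t) * exp (1 / (2 * t) * (norm (z - w))\<^sup>2 + 1 / t * Re (hdot z w))) *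
        cmod (berezin t f w z) * cmod (g w)"
      unfolding I_integrand_def norm_scaleR norm_mult norm_of_real abs_exp_cancel by (simp only: mult.assoc)
    also have "\<dots> \<le> ?e * exp (- (norm w)\<^sup>2 / (2 * t)) * (S * exp (- c * (norm (z - w))\<^sup>2)) * cmod (g w)"
      unfolding e by (intro mult_right_mono mult_left_mono ber) auto
    also have "\<dots> = ?e * S * (exp (- c * (norm (z - w))\<^sup>2) * weighted t g w)"
      by (simp only: weighted_def mult_ac)
    finally show ?thesis .
  qed
  have "cmod (I_op t f g z) = 1 / (pi * t) ^ CARD('n) * cmod (LINT w|lebesgue. exp (- (norm w)\<^sup>2 / t) *\<^sub>R I_integrand t f g z w)"
    unfolding I_op_def integral_gauss[OF t Im] using t by simp
  also have "\<dots> \<le> 1 / (pi * t) ^ CARD('n) * (LINT w|lebesgue. ?e * S * (exp (- c * (norm (z - w))\<^sup>2) * weighted t g w))"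
    using t by (intro mult_left_mono Bochner_Integration.integral_norm_bound_integral iI' integrable_mult_right ic le) auto
  also have "\<dots> = ?e * (S / (pi * t) ^ CARD('n) * (LINT w|lebesgue. exp (- c * (norm (z - w))\<^sup>2) * weighted t g w))"
    unfolding integral_mult_right_zero by (simp add: mult_ac)
  finally have "cmod (I_op t f g z) * exp (- (norm z)\<^sup>2 / (2 * t)) \<le>
      ?e * (S / (pi * t) ^ CARD('n) * (LINT w|lebesgue. exp (- c * (norm (z - w))\<^sup>2) * weighted t g w)) * exp (- (norm z)\<^sup>2 / (2 * t))"
    by (intro mult_right_mono) auto
  also have "\<dots> = (?e * exp (- (norm z)\<^sup>2 / (2 * t))) * (S / (pi * t) ^ CARD('n) * (LINT w|lebesgue. exp (- c * (norm (z - w))\<^sup>2) * weighted t g w))"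
    by (simp only: mult_ac)
  also have "?e * exp (- (norm z)\<^sup>2 / (2 * t)) = 1"
    by (simp add: exp_add[symmetric])
  finally show ?thesis by (simp only: weighted_def mult_1_left)
qed

text \<open>For the infinite exponent, \<open>gaussian_convolution_bound\<close> with integrable
  part 0 gives the kernel's mass times the essential supremum; finite exponents are Young's
  inequality. The constant is the same in both cases.\<close>

lemma weighted_convolution_Lt:
  fixes F g :: "complex ^ 'n::finite \<Rightarrow> complex"
  assumes t: "t > 0" and p: "1 \<le> p" and c: "c > 0" and \<kappa>: "\<kappa> \<ge> 0"
    and F: "F \<in> borel_measurable lebesgue" and g: "g \<in> Lt_space t p"
    and le: "\<And>z. weighted t F z \<le> \<kappa> * (LINT w|lebesgue. exp (- c * (norm (z - w))\<^sup>2) * weighted t g w)"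
  shows "F \<in> Lt_space t p \<and> Lt_norm t p F \<le> \<kappa> * (pi / c) ^ CARD('n) * Lt_norm t p g"
proof (cases "p = \<infinity>")
  case True
  define S where "S = enn2real (Linf_t_norm t g)"
  have gm: "g \<in> borel_measurable lebesgue" and fin: "Linf_t_norm t g < \<infinity>"
    using g True by (auto simp: Lt_space_def)
  have S: "Linf_t_norm t g = ennreal S" "S \<ge> 0" using fin by (simp_all add: S_def less_top)
  have "AE w in lebesgue. weighted t g w \<le> S + 0"
    using esssup_AE[of "\<lambda>w. ennreal (cmod (g w * of_real (exp (- (norm w)\<^sup>2 / (2 * t)))))" lebesgue]
    unfolding Linf_t_norm_def[symmetric] S by eventually_elim (use S(2) in \<open>simp add: weighted_def norm_mult\<close>)
  note b = gaussian_convolution_bound(2)[OF c borel_measurable_weighted[OF gm] weighted_nonneg _ _ S(2) this]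
  define L where "L = \<kappa> * (pi / c) ^ CARD('n) * S"
  have "weighted t F z \<le> L" for z
    using order_trans[OF le mult_left_mono[OF b \<kappa>], of z] by (simp add: L_def mult_ac)
  then have "Linf_t_norm t F \<le> ennreal L"
    unfolding Linf_t_norm_def
  proof (intro esssup_I always_eventually allI)
    show "(\<lambda>z. ennreal (cmod (F z * of_real (exp (- (norm z)\<^sup>2 / (2 * t)))))) \<in> borel_measurable lebesgue"
      using borel_measurable_weighted[OF F, of t] by (simp add: weighted_def[abs_def] norm_mult)
  qed (simp add: weighted_def norm_mult ennreal_leI)
  moreover have "L \<ge> 0" using \<kappa> c S by (simp add: L_def)
  ultimately show ?thesis
    using True F S enn2real_mono[of "Linf_t_norm t F" "ennreal L"]
    by (auto simp: Lt_space_def Lt_norm_def L_def less_top[symmetric] top_unique neq_top_trans)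
next
  case False
  have q: "enn2real p \<ge> 1" using enn2real_mono[OF p] False by (simp add: less_top)
  show ?thesis
    using weighted_convolution_Lp[OF t q c \<kappa> F _ le] g False by (simp add: Lt_space_def Lt_norm_def)
qed

theorem theorem3p4:
  fixes t s :: real
  assumes "t > 0" and "0 < s" and "s < t / 2"
  shows "\<exists>C>0. \<forall>f :: complex ^ 'n::finite \<Rightarrow> complex.
    f \<in> borel_measurable lebesgue \<longrightarrow>
    (\<forall>z. (\<lambda>u. f u * K t z u) \<in> Lp_space (gauss t) 2) \<longrightarrow>
    bounded (range (berezin_diag s f)) \<longrightarrow>
      (\<forall>p. 1 \<le> p \<longrightarrow>
        (\<forall>g \<in> Lt_space t p.
           (\<forall>z. integrable (gauss t) (I_integrand t f g z)) \<and>
           I_op t f g \<in> Ft_space t p \<and>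
           Lt_norm t p (I_op t f g) \<le> C * sup_norm (berezin_diag s f) * Lt_norm t p g)) \<and>
      (\<forall>p. 1 \<le> p \<and> p < \<infinity> \<longrightarrow>
        (\<forall>h \<in> toeplitz_dom t p f.
           (\<forall>z. integrable (gauss t) (P_integrand t (\<lambda>w. f w * h w) z)) \<and>
           toeplitz t f h \<in> Ft_space t p \<and>
           Lt_norm t p (toeplitz t f h) \<le> C * sup_norm (berezin_diag s f) * Lt_norm t p h))"
proof -
  \<comment> \<open>The off-diagonal decay rate; its positivity is where \<open>s < t / 2\<close>
    enters.\<close>
  define c where "c = 1 / (2 * t) - 1 / (4 * (t - s))"
  have "2 * t < 4 * (t - s)" using assms by simp
  then have "1 / (4 * (t - s)) < 1 / (2 * t)" using assms(1) by (intro divide_strict_left_mono) auto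
  then have c: "c > 0" by (simp add: c_def)
  \<comment> \<open>Normalisation of \<open>gauss t\<close> times the mass of the convolving
    Gaussian. It is fixed before f and p are chosen.\<close>
  define C where "C = 1 / (pi * t) ^ CARD('n) * (pi / c) ^ CARD('n)"
  have C: "C > 0" using assms(1) c by (simp add: C_def)
  have st: "s < t" using assms by simp
  show ?thesis
  proof (intro exI[of _ C] conjI allI impI C)
    fix f :: "complex ^ 'n \<Rightarrow> complex"
    assume f: "f \<in> borel_measurable lebesgue"
      and fK: "\<forall>z. (\<lambda>u. f u * K t z u) \<in> Lp_space (gauss t) 2"
      and bd: "bounded (range (berezin_diag s f))"
    define S where "S = sup_norm (berezin_diag s f)"
    have S: "S \<ge> 0" unfolding S_def by (rule sup_norm_nonneg[OF bd])
    have w: "integrable lebesgue (\<lambda>u. cmod (f u) * exp (N * norm u - (norm u)\<^sup>2 / (2 * t)))" if "N \<ge> 0" for N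
      using fK by (intro integrable_exp_weight[OF assms(1) f] that) auto
    have ber: "cmod (berezin t f w z) \<le> S * exp (- c * (norm (z - w))\<^sup>2)" for z w
      unfolding S_def c_def by (rule berezin_off_diagonal_bound[OF assms(1,2) st f w bd])
    \<comment> \<open>The last clause carries part (ii): for entire g the inner projection
      disappears from the factorisation of \<open>I_op\<close>, and the Toeplitz operator inherits
      the bound of part (i).\<close>
    have main: "(\<forall>z. integrable (gauss t) (I_integrand t f g z)) \<and>
        I_op t f g \<in> Ft_space t p \<and> Lt_norm t p (I_op t f g) \<le> C * S * Lt_norm t p g \<and>
        (entire g \<longrightarrow> (\<forall>z. integrable (gauss t) (P_integrand t (\<lambda>u. f u * g u) z)) \<and> toeplitz t f g = I_op t f g)"
      if p: "1 \<le> p" and g: "g \<in> Lt_space t p" for p g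
    proof -
      obtain A \<psi> where d: "g \<in> borel_measurable lebesgue" "A \<ge> 0" "integrable lebesgue \<psi>" "\<And>w. \<psi> w \<ge> 0"
          "AE w in lebesgue. weighted t g w \<le> A + \<psi> w"
        using Lt_space_dominated[OF assms(1) p g] by blast
      obtain M where M: "\<And>u. integrable (gauss t) (P_integrand t g u)"
          "\<And>u. (LINT w|gauss t. cmod (P_integrand t g u w)) \<le> M * exp ((norm u)\<^sup>2 / (2 * t))"
        using P_integrand_bound[OF assms(1) d] by blast
      note I = I_op_eq_toeplitz_P_op[OF assms(1) f w d(1) M]
      have "weighted t (I_op t f g) z \<le>
          S / (pi * t) ^ CARD('n) * (LINT w|lebesgue. exp (- c * (norm (z - w))\<^sup>2) * weighted t g w)" for z
        by (rule weighted_I_op_le[OF assms(1) ber d(1) I(1)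
              gaussian_convolution_bound(1)[OF c borel_measurable_weighted[OF d(1)] weighted_nonneg d(3,4,2,5)]])
      then have "I_op t f g \<in> Lt_space t p \<and>
          Lt_norm t p (I_op t f g) \<le> S / (pi * t) ^ CARD('n) * (pi / c) ^ CARD('n) * Lt_norm t p g"
        using assms(1) S
        by (intro weighted_convolution_Lt[OF assms(1) p c _ _ g] measurable_lebesgue_borel
              entire_borel_measurable I(4)) auto
      moreover have "(\<forall>z. integrable (gauss t) (P_integrand t (\<lambda>u. f u * g u) z)) \<and> toeplitz t f g = I_op t f g"
        if "entire g"
      proof -
        have "P_op t g = g" using P_op_entire[OF assms(1) that M(1)] by blast
        note I(2,3)[unfolded this]
        then show ?thesis by (simp add: fun_eq_iff)
      qed
      ultimately show ?thesis
        using I(1,4) by (auto simp: Ft_space_def C_def mult_ac)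
    qed
    {
      fix p :: ennreal assume "1 \<le> p"
      then show "\<forall>g \<in> Lt_space t p. (\<forall>z. integrable (gauss t) (I_integrand t f g z)) \<and>
          I_op t f g \<in> Ft_space t p \<and>
          Lt_norm t p (I_op t f g) \<le> C * sup_norm (berezin_diag s f) * Lt_norm t p g"
        using main by (simp add: S_def)
    next
      fix p :: ennreal assume "1 \<le> p \<and> p < \<infinity>"
      then have p: "1 \<le> p" by simp
      show "\<forall>h \<in> toeplitz_dom t p f.
          (\<forall>z. integrable (gauss t) (P_integrand t (\<lambda>w. f w * h w) z)) \<and>
          toeplitz t f h \<in> Ft_space t p \<and>
          Lt_norm t p (toeplitz t f h) \<le> C * sup_norm (berezin_diag s f) * Lt_norm t p h"
      proof
        fix h assume "h \<in> toeplitz_dom t p f"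
        then have "h \<in> Lt_space t p" "entire h" by (simp_all add: toeplitz_dom_def Ft_space_def)
        with main[OF p, of h] show "(\<forall>z. integrable (gauss t) (P_integrand t (\<lambda>w. f w * h w) z)) \<and>
          toeplitz t f h \<in> Ft_space t p \<and>
          Lt_norm t p (toeplitz t f h) \<le> C * sup_norm (berezin_diag s f) * Lt_norm t p h"
          by (simp add: S_def)
      qed
    }
  qed
qed

end
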